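(* Let $\Gamma$ be a discrete group with Kazhdan's property (T), and let $\{\Gamma_\alpha\}_{\alpha\in I}$ be an uncountable family of pairwise non-isomorphic quotient groups of $\Gamma$, each of which is simple and ICC. Let $M$ be a separable $\mathrm{II}_1$-factor, with unitary group $\mathcal{U}(M)$. Then the set $$\{\alpha\in I : \mathcal{U}(M)\text{ contains a subgroup isomorphic to }\Gamma_\alpha\}$$ is at most countable.
   Context: A discrete group $\Gamma$ has Kazhdan's property (T) if the trivial representation is isolated in the dual $\hat{\Gamma}$ equipped with the Fell topology. Equivalently, there are a finite subset $E$ of generators of $\Gamma$ and a function $f\colon\mathbb{R}_+\to\mathbb{R}_+$ which is monotone with $\lim_{\varepsilon\to0}f(\varepsilon)=0$, such that whenever $\pi$ is a unitary representation of $\Gamma$ on a Hilbert space $\mathcal{H}$ and $\xi\in\mathcal{H}$ is a unit vector with $\varepsilon=\max_{s\in E}\|\pi(s)\xi-\xi\|$, there is a vector $\eta\in\mathcal{H}$ with $\|\xi-\eta\|<f(\varepsilon)$ and $\pi(s)\eta=\eta$ for all $s\in\Gamma$. (Here $f(\varepsilon)$ decreases to $0$ as $\varepsilon$ decreases to $0$.) A group is ICC (infinite conjugacy classes) if every conjugacy class other than that of the identity is infinite. A $\mathrm{II}_1$-factor is separable if it has separable predual (equivalently, it acts faithfully as a von Neumann algebra on a separable Hilbert space). "Pairwise non-isomorphic" means that $\Gamma_\alpha\not\cong\Gamma_\beta$ as groups for $\alpha\neq\beta$ in the (uncountable) index set $I$. *)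

theory Defs
  imports "HOL-Analysis.Analysis" "HOL-Algebra.Algebra" "HOL-Algebra.Algebraic_Closure_Type"
begin

section \<open>Complex Hilbert spaces\<close>

text \<open>
  Hilbert spaces are structures with an explicit carrier, so that one can quantify over them
  inside a definition (see \<open>property_T\<close> below). The vector space part is a module of HOL-Algebra
  over the field of complex numbers; the ring multiplication and unit that a module record
  inherits play no role. The inner product is linear in its first argument.
\<close>

record 'h hilbert = "(complex, 'h) module" +
  cinner :: "'h \<Rightarrow> 'h \<Rightarrow> complex"

definition hnorm :: "'h hilbert \<Rightarrow> 'h \<Rightarrow> real" where
  "hnorm H x = sqrt (Re (cinner H x x))"

definition hilbert_space :: "'h hilbert \<Rightarrow> bool" where
  "hilbert_space H \<longleftrightarrow>
     module (ring_of_type_algebra :: complex ring) H \<and>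
     (\<forall>x\<in>carrier H. \<forall>y\<in>carrier H. \<forall>z\<in>carrier H.
        cinner H (x \<oplus>\<^bsub>H\<^esub> y) z = cinner H x z + cinner H y z) \<and>
     (\<forall>c. \<forall>x\<in>carrier H. \<forall>y\<in>carrier H. cinner H (c \<odot>\<^bsub>H\<^esub> x) y = c * cinner H x y) \<and>
     (\<forall>x\<in>carrier H. \<forall>y\<in>carrier H. cinner H y x = cnj (cinner H x y)) \<and>
     (\<forall>x\<in>carrier H. x \<noteq> \<zero>\<^bsub>H\<^esub> \<longrightarrow> 0 < Re (cinner H x x)) \<and>
     (\<forall>u. (\<forall>n. u n \<in> carrier H) \<longrightarrow>
          (\<forall>e>0. \<exists>k. \<forall>m\<ge>k. \<forall>n\<ge>k. hnorm H (u m \<ominus>\<^bsub>H\<^esub> u n) < e) \<longrightarrow>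
          (\<exists>x\<in>carrier H. (\<lambda>n::nat. hnorm H (u n \<ominus>\<^bsub>H\<^esub> x)) \<longlonglongrightarrow> 0))"

text \<open>
  Operators are functions that are \<open>undefined\<close> outside the carrier, so that equality of
  operators is equality of functions, and the product of operators is \<^const>\<open>compose\<close> on the
  carrier.
\<close>

definition bounded_ops :: "'h hilbert \<Rightarrow> ('h \<Rightarrow> 'h) set" where
  "bounded_ops H = {T \<in> carrier H \<rightarrow>\<^sub>E carrier H.
     (\<forall>x\<in>carrier H. \<forall>y\<in>carrier H. T (x \<oplus>\<^bsub>H\<^esub> y) = T x \<oplus>\<^bsub>H\<^esub> T y) \<and>
     (\<forall>c. \<forall>x\<in>carrier H. T (c \<odot>\<^bsub>H\<^esub> x) = c \<odot>\<^bsub>H\<^esub> T x) \<and>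
     (\<exists>B. \<forall>x\<in>carrier H. hnorm H (T x) \<le> B * hnorm H x)}"

definition id_op :: "'h hilbert \<Rightarrow> 'h \<Rightarrow> 'h" where
  "id_op H = (\<lambda>x\<in>carrier H. x)"

definition adj_op :: "'h hilbert \<Rightarrow> ('h \<Rightarrow> 'h) \<Rightarrow> 'h \<Rightarrow> 'h" where
  "adj_op H T = (THE S. S \<in> bounded_ops H \<and>
     (\<forall>x\<in>carrier H. \<forall>y\<in>carrier H. cinner H (T x) y = cinner H x (S y)))"

definition unitary_op :: "'h hilbert \<Rightarrow> ('h \<Rightarrow> 'h) \<Rightarrow> bool" where
  "unitary_op H U \<longleftrightarrow> U \<in> bounded_ops H \<and> U ` carrier H = carrier H \<and>
     (\<forall>x\<in>carrier H. \<forall>y\<in>carrier H. cinner H (U x) (U y) = cinner H x y)"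

definition unitary_group :: "'h hilbert \<Rightarrow> ('h \<Rightarrow> 'h) set \<Rightarrow> ('h \<Rightarrow> 'h) monoid" where
  "unitary_group H M =
     \<lparr>carrier = {U \<in> M. unitary_op H U}, mult = compose (carrier H), one = id_op H\<rparr>"


section \<open>Property (T), simple groups and ICC groups\<close>

definition unitary_rep :: "('g, 'm) monoid_scheme \<Rightarrow> 'h hilbert \<Rightarrow> ('g \<Rightarrow> 'h \<Rightarrow> 'h) \<Rightarrow> bool" where
  "unitary_rep G H \<pi> \<longleftrightarrow> hilbert_space H \<and> \<pi> \<in> hom G (unitary_group H (bounded_ops H))"

text \<open>
  The Hilbert spaces range over all structures whose carrier is a set of functions
  \<open>'g \<Rightarrow> complex\<close>. This loses nothing. For a unitary representation \<open>\<pi>\<close> on an arbitrary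
  Hilbert space and a unit vector \<open>\<xi>\<close>, let \<open>K\<close> be the closed linear span of the orbit of \<open>\<xi>\<close>. It
  is invariant, and the map that sends \<open>\<eta> \<in> K\<close> to the function \<open>g \<mapsto> \<langle>\<eta>, \<pi> g \<xi>\<rangle>\<close> is linear and
  injective on \<open>K\<close>, so the representation on \<open>K\<close> is equivalent to one considered here, and the
  condition below for the latter (with the same \<open>E\<close> and \<open>f\<close>) gives the one for \<open>\<pi>\<close> and \<open>\<xi>\<close>.

  The function \<open>f\<close> is defined on the positive reals. For \<open>\<epsilon> = 0\<close> the vector \<open>\<xi>\<close> is itself
  invariant, because \<open>E\<close> generates the group; the strict inequality with \<open>f 0\<close> is not demanded in
  that case, since monotonicity and \<open>f \<epsilon> \<rightarrow> 0\<close> would force \<open>f 0 = 0\<close>. Nonemptiness of \<open>E\<close> only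
  makes the maximum meaningful.
\<close>

definition property_T :: "('g, 'm) monoid_scheme \<Rightarrow> bool" where
  "property_T G \<longleftrightarrow>
     (\<exists>E f. finite E \<and> E \<noteq> {} \<and> E \<subseteq> carrier G \<and> generate G E = carrier G \<and>
        (\<forall>\<epsilon>>0. 0 < f \<epsilon>) \<and> mono_on {0<..} f \<and> (f \<longlongrightarrow> 0) (at_right (0::real)) \<and>
        (\<forall>(H :: ('g \<Rightarrow> complex) hilbert) \<pi> \<xi> \<epsilon>.
           unitary_rep G H \<pi> \<longrightarrow> \<xi> \<in> carrier H \<longrightarrow> hnorm H \<xi> = 1 \<longrightarrow>
           \<epsilon> = Max ((\<lambda>s. hnorm H (\<pi> s \<xi> \<ominus>\<^bsub>H\<^esub> \<xi>)) ` E) \<longrightarrow> 0 < \<epsilon> \<longrightarrow>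
           (\<exists>\<eta>\<in>carrier H. hnorm H (\<xi> \<ominus>\<^bsub>H\<^esub> \<eta>) < (f \<epsilon> :: real) \<and>
              (\<forall>s\<in>carrier G. \<pi> s \<eta> = \<eta>))))"

text \<open>
  The locale \<^locale>\<open>simple_group\<close> requires \<open>order G > 1\<close>, where the order of an infinite group is
  0, and therefore excludes all infinite groups. The following notion does not.
\<close>

definition is_simple :: "('g, 'm) monoid_scheme \<Rightarrow> bool" where
  "is_simple G \<longleftrightarrow> group G \<and> carrier G \<noteq> {\<one>\<^bsub>G\<^esub>} \<and>
     (\<forall>K. K \<lhd> G \<longrightarrow> K = carrier G \<or> K = {\<one>\<^bsub>G\<^esub>})"

definition icc :: "('g, 'm) monoid_scheme \<Rightarrow> bool" where
  "icc G \<longleftrightarrow> (\<forall>x\<in>carrier G. x \<noteq> \<one>\<^bsub>G\<^esub> \<longrightarrow>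
     infinite ((\<lambda>g. g \<otimes>\<^bsub>G\<^esub> x \<otimes>\<^bsub>G\<^esub> inv\<^bsub>G\<^esub> g) ` carrier G))"


section \<open>Von Neumann algebras and \<open>II\<^sub>1\<close>-factors\<close>

definition commutant :: "'h hilbert \<Rightarrow> ('h \<Rightarrow> 'h) set \<Rightarrow> ('h \<Rightarrow> 'h) set" where
  "commutant H S = {T \<in> bounded_ops H.
     \<forall>A\<in>S. compose (carrier H) T A = compose (carrier H) A T}"

text \<open>
  A self-adjoint set of operators that equals its bicommutant is automatically a unital
  *-subalgebra.
\<close>

definition von_neumann_algebra :: "'h hilbert \<Rightarrow> ('h \<Rightarrow> 'h) set \<Rightarrow> bool" where
  "von_neumann_algebra H M \<longleftrightarrow> hilbert_space H \<and> M \<subseteq> bounded_ops H \<and>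
     (\<forall>T\<in>M. adj_op H T \<in> M) \<and> commutant H (commutant H M) = M"

definition factor :: "'h hilbert \<Rightarrow> ('h \<Rightarrow> 'h) set \<Rightarrow> bool" where
  "factor H M \<longleftrightarrow> von_neumann_algebra H M \<and>
     M \<inter> commutant H M = range (\<lambda>c. \<lambda>x\<in>carrier H. c \<odot>\<^bsub>H\<^esub> x)"

definition finite_dim_ops :: "'h hilbert \<Rightarrow> ('h \<Rightarrow> 'h) set \<Rightarrow> bool" where
  "finite_dim_ops H M \<longleftrightarrow> (\<exists>F. finite F \<and> F \<subseteq> M \<and>
     (\<forall>T\<in>M. \<exists>c. \<forall>x\<in>carrier H. T x = (\<Oplus>\<^bsub>H\<^esub>A\<in>F. c A \<odot>\<^bsub>H\<^esub> A x)))"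

text \<open>
  The predual consists of the normal (that is, ultraweakly continuous) linear functionals on \<open>M\<close>,
  which are the restrictions to \<open>M\<close> of the functionals
  \<open>T \<mapsto> \<Sum>\<^sub>n \<langle>T \<xi>\<^sub>n, \<eta>\<^sub>n\<rangle>\<close> with square-summable sequences \<open>\<xi>\<close> and \<open>\<eta>\<close> of vectors.
\<close>

definition predual :: "'h hilbert \<Rightarrow> ('h \<Rightarrow> 'h) set \<Rightarrow> (('h \<Rightarrow> 'h) \<Rightarrow> complex) set" where
  "predual H M = {\<phi> \<in> extensional M. \<exists>\<xi> \<eta> :: nat \<Rightarrow> 'h.
     (\<forall>n. \<xi> n \<in> carrier H \<and> \<eta> n \<in> carrier H) \<and>
     summable (\<lambda>n. (hnorm H (\<xi> n))\<^sup>2) \<and> summable (\<lambda>n. (hnorm H (\<eta> n))\<^sup>2) \<and>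
     (\<forall>T\<in>M. (\<lambda>n. cinner H (T (\<xi> n)) (\<eta> n)) sums \<phi> T)}"

definition unit_ball_ops :: "'h hilbert \<Rightarrow> ('h \<Rightarrow> 'h) set \<Rightarrow> ('h \<Rightarrow> 'h) set" where
  "unit_ball_ops H M = {T \<in> M. \<forall>x\<in>carrier H. hnorm H (T x) \<le> hnorm H x}"

text \<open>Separability refers to the norm of functionals, the supremum over the unit ball of \<open>M\<close>.\<close>

definition separable_predual :: "'h hilbert \<Rightarrow> ('h \<Rightarrow> 'h) set \<Rightarrow> bool" where
  "separable_predual H M \<longleftrightarrow> (\<exists>D. countable D \<and> D \<subseteq> predual H M \<and>
     (\<forall>\<phi>\<in>predual H M. \<forall>e>0. \<exists>\<psi>\<in>D. \<forall>T\<in>unit_ball_ops H M. cmod (\<phi> T - \<psi> T) \<le> e))"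

definition faithful_normal_tracial_state ::
    "'h hilbert \<Rightarrow> ('h \<Rightarrow> 'h) set \<Rightarrow> (('h \<Rightarrow> 'h) \<Rightarrow> complex) \<Rightarrow> bool" where
  "faithful_normal_tracial_state H M \<tau> \<longleftrightarrow> \<tau> \<in> predual H M \<and> \<tau> (id_op H) = 1 \<and>
     (\<forall>S\<in>M. \<forall>T\<in>M. \<tau> (compose (carrier H) S T) = \<tau> (compose (carrier H) T S)) \<and>
     (\<forall>T\<in>M. \<tau> (compose (carrier H) (adj_op H T) T) \<in> \<real>\<^sub>\<ge>\<^sub>0) \<and>
     (\<forall>T\<in>M. \<tau> (compose (carrier H) (adj_op H T) T) = 0 \<longrightarrow> T = (\<lambda>x\<in>carrier H. \<zero>\<^bsub>H\<^esub>))"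

definition II1_factor :: "'h hilbert \<Rightarrow> ('h \<Rightarrow> 'h) set \<Rightarrow> bool" where
  "II1_factor H M \<longleftrightarrow> factor H M \<and> \<not> finite_dim_ops H M \<and>
     (\<exists>\<tau>. faithful_normal_tracial_state H M \<tau>)"

end

theory Submission
  imports Defs
begin

text \<open>
  Each \<open>\<Gamma>\<^sub>\<alpha>\<close> that embeds in the unitary group gives a homomorphism \<open>\<rho>\<^sub>\<alpha>\<close> from \<open>\<Gamma>\<close> with kernel \<open>N\<^sub>\<alpha>\<close>.
  Faithfulness of the trace \<open>\<tau>\<close> makes \<open>\<rho>\<^sub>\<alpha>\<close> move the unit by more than some \<open>1/n\<close> in the 2-norm; if there
  were uncountably many \<open>\<alpha>\<close>, one \<open>n\<close> would serve uncountably many of them, and by separability two of these,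
  \<open>\<alpha> \<noteq> \<beta>\<close>, would be as close as we please on the finite set of generators. The function
  \<open>\<phi> s = \<tau> (\<rho>\<^sub>\<alpha> s \<cdot> (\<rho>\<^sub>\<beta> s)\<inverse>)\<close> is positive definite, so property (T), applied to the Hilbert space of
  its kernel, makes \<open>\<phi>\<close> uniformly close to 1. Since the two quotients are simple with different kernels,
  \<open>\<rho>\<^sub>\<beta>\<close> maps \<open>N\<^sub>\<alpha>\<close> onto its whole range, while \<open>\<rho>\<^sub>\<alpha>\<close> is trivial there: all of \<open>\<rho>\<^sub>\<beta>\<close> is closer to the unit
  than \<open>1/n\<close>, a contradiction.

  The completion needed for the Hilbert space of a kernel is carried out inside the functions on the
  group: its elements are the pointwise limits of Cauchy sequences of finite linear combinations.
\<close>

section \<open>The Hilbert space of a positive definite kernel\<close>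

text \<open>Finite linear combinations of points are represented by lists of coefficient-point pairs.\<close>

definition kernel_form :: "('x \<Rightarrow> 'x \<Rightarrow> complex) \<Rightarrow> (complex \<times> 'x) list \<Rightarrow> (complex \<times> 'x) list \<Rightarrow> complex" where
  "kernel_form K l m = (\<Sum>(c, s)\<leftarrow>l. \<Sum>(d, t)\<leftarrow>m. c * cnj d * K s t)"

definition comb_scale :: "complex \<Rightarrow> (complex \<times> 'x) list \<Rightarrow> (complex \<times> 'x) list" where
  "comb_scale c = map (\<lambda>(d, s). (c * d, s))"

text \<open>Lists are concatenated and never normalised, so many lists stand for the same vector;
  only the values of \<open>kernel_form\<close> are meaningful.\<close>

definition comb_diff :: "(complex \<times> 'x) list \<Rightarrow> (complex \<times> 'x) list \<Rightarrow> (complex \<times> 'x) list" where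
  "comb_diff l m = l @ comb_scale (-1) m"

text \<open>Membership in \<open>\<real>\<^sub>\<ge>\<^sub>0\<close> makes the values of the form on
  the diagonal real as well as nonnegative; Hermitian symmetry then follows by polarisation in
  \<open>form_hermitian\<close>.\<close>

locale pos_def_kernel =
  fixes A :: "'x set" and K :: "'x \<Rightarrow> 'x \<Rightarrow> complex"
  assumes form_nonneg: "snd ` set l \<subseteq> A \<Longrightarrow> kernel_form K l l \<in> \<real>\<^sub>\<ge>\<^sub>0"
begin

abbreviation form where "form \<equiv> kernel_form K"
definition comb where "comb = {l :: (complex \<times> 'x) list. snd ` set l \<subseteq> A}"
definition qform where "qform l = Re (form l l)"

section \<open>The Hermitian form on finite combinations\<close>

lemma form_Nil [simp]: "form [] m = 0" "form l [] = 0"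
  by (simp_all add: kernel_form_def case_prod_unfold)

lemma form_append_left [simp]: "form (l @ l') m = form l m + form l' m"
  by (simp add: kernel_form_def)

lemma form_append_right [simp]: "form l (m @ m') = form l m + form l m'"
  by (simp add: kernel_form_def sum_list_addf case_prod_unfold)

lemma form_Cons_right: "form l (p # m) = form l [p] + form l m"
  using form_append_right[of l "[p]" m] by simp

lemma form_scale_left [simp]: "form (comb_scale c l) m = c * form l m"
proof -
  have "form (comb_scale c l) m = (\<Sum>x\<leftarrow>l. c * (\<Sum>y\<leftarrow>m. fst x * cnj (fst y) * K (snd x) (snd y)))"
    by (simp add: kernel_form_def comb_scale_def case_prod_unfold o_def sum_list_const_mult [symmetric] mult.assoc)
  then show ?thesis
    by (simp add: kernel_form_def sum_list_const_mult case_prod_unfold)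
qed

lemma form_scale_right [simp]: "form l (comb_scale c m) = cnj c * form l m"
proof -
  have "form l (comb_scale c m) = (\<Sum>x\<leftarrow>l. cnj c * (\<Sum>y\<leftarrow>m. fst x * cnj (fst y) * K (snd x) (snd y)))"
    by (simp add: kernel_form_def comb_scale_def case_prod_unfold o_def sum_list_const_mult [symmetric] mult_ac)
  then show ?thesis
    by (simp add: kernel_form_def sum_list_const_mult case_prod_unfold)
qed

lemma form_diff [simp]:
  "form (comb_diff l l') m = form l m - form l' m" "form l (comb_diff m m') = form l m - form l m'"
  by (simp_all add: comb_diff_def)

lemma comb_Nil [simp]: "[] \<in> comb"
  by (simp add: comb_def)

lemma comb_point [simp]: "s \<in> A \<Longrightarrow> [(c, s)] \<in> comb"
  by (simp add: comb_def)

lemma comb_append [simp]: "l \<in> comb \<Longrightarrow> m \<in> comb \<Longrightarrow> l @ m \<in> comb"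
  by (auto simp: comb_def)

lemma comb_scale_comb [simp]: "l \<in> comb \<Longrightarrow> comb_scale c l \<in> comb"
  by (force simp: comb_def comb_scale_def)

lemma comb_diff_comb [simp]: "l \<in> comb \<Longrightarrow> m \<in> comb \<Longrightarrow> comb_diff l m \<in> comb"
  by (simp add: comb_diff_def)

lemma form_self: "l \<in> comb \<Longrightarrow> form l l = of_real (qform l)"
  using form_nonneg[of l] by (simp add: comb_def qform_def complex_nonneg_Reals_iff complex_eq_iff)

lemma qform_nonneg [simp]: "l \<in> comb \<Longrightarrow> 0 \<le> qform l"
  using form_nonneg[of l] by (simp add: comb_def qform_def complex_nonneg_Reals_iff)

text \<open>Polarisation: the form is real at \<open>l + m\<close>, which cancels the imaginary
  parts of the two mixed terms, and at \<open>l + \<i> m\<close>, which equates their real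
  parts.\<close>

lemma form_hermitian:
  assumes "l \<in> comb" "m \<in> comb"
  shows "form m l = cnj (form l m)"
proof -
  have "Im (form (l @ m) (l @ m)) = 0" "Im (form (l @ comb_scale \<i> m) (l @ comb_scale \<i> m)) = 0"
    by (subst form_self; simp add: assms)+
  moreover have "Im (form l l) = 0" "Im (form m m) = 0"
    by (subst form_self; simp add: assms)+
  ultimately show ?thesis
    by (simp add: complex_eq_iff algebra_simps)
qed

lemma qform_parallelogram:
  "qform (comb_diff l m) + qform (l @ m) = 2 * qform l + 2 * qform m"
  by (simp add: qform_def)

lemma qform_diff_sym: "qform (comb_diff l m) = qform (comb_diff m l)"
  by (simp add: qform_def)

lemma qform_diff_self [simp]: "qform (comb_diff l l) = 0"
  by (simp add: qform_def)

text \<open>The parallelogram law with one nonnegative term dropped. The factor 2 spares square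
  roots and is harmless in all convergence arguments.\<close>

lemma qform_diff_triangle:
  assumes "l \<in> comb" "m \<in> comb" "n \<in> comb"
  shows "qform (comb_diff l n) \<le> 2 * qform (comb_diff l m) + 2 * qform (comb_diff m n)"
proof -
  have "qform (comb_diff (comb_diff l m) (comb_diff m n)) \<ge> 0"
    using assms by simp
  moreover have "qform (comb_diff l m @ comb_diff m n) = qform (comb_diff l n)"
    by (simp add: qform_def algebra_simps)
  ultimately show ?thesis
    using qform_parallelogram[of "comb_diff l m" "comb_diff m n"] by linarith
qed

text \<open>Nonnegativity of \<open>qform\<close> at \<open>l - r z m\<close> with
  \<open>z = form l m\<close> and \<open>r\<close> real. The form may be degenerate, so
  \<open>qform m = 0\<close> is a separate case.\<close>

lemma form_Cauchy_Schwarz: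
  assumes "l \<in> comb" "m \<in> comb"
  shows "(cmod (form l m))\<^sup>2 \<le> qform l * qform m"
proof -
  define z where "z = form l m"
  have *: "0 \<le> qform l - 2 * r * (cmod z)\<^sup>2 + r\<^sup>2 * (cmod z)\<^sup>2 * qform m" for r :: real
  proof -
    let ?d = "comb_diff l (comb_scale (of_real r * z) m)"
    have "form ?d ?d = form l l - 2 * of_real r * (z * cnj z) + (of_real r)\<^sup>2 * (z * cnj z) * form m m"
      using form_hermitian[OF assms] by (simp add: z_def power2_eq_square algebra_simps)
    also have "\<dots> = of_real (qform l - 2 * r * (cmod z)\<^sup>2 + r\<^sup>2 * (cmod z)\<^sup>2 * qform m)"
      unfolding complex_norm_square [symmetric] form_self[OF assms(1)] form_self[OF assms(2)] by simp
    finally have "qform ?d = qform l - 2 * r * (cmod z)\<^sup>2 + r\<^sup>2 * (cmod z)\<^sup>2 * qform m"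
      by (simp only: qform_def [of ?d] Re_complex_of_real)
    then show ?thesis
      using assms qform_nonneg[of ?d] by simp
  qed
  show ?thesis
  proof (cases "qform m = 0")
    case True
    have "(cmod z)\<^sup>2 \<le> 0"
    proof (rule ccontr)
      assume "\<not> (cmod z)\<^sup>2 \<le> 0"
      then show False
        \<comment> \<open>With \<open>qform m = 0\<close> the expression is affine in
          \<open>r\<close>, and this \<open>r\<close> brings it down to -1.\<close>
        using *[of "(qform l + 1) / (2 * (cmod z)\<^sup>2)"] True by (simp add: field_simps)
    qed
    then show ?thesis
      using True by (simp add: z_def)
  next
    case False
    then have "qform m > 0"
      using assms(2) qform_nonneg[of m] by linarith
    then show ?thesis
      using *[of "1 / qform m"] by (simp add: z_def field_simps power2_eq_square)
  qed
qed

section \<open>Cauchy sequences of combinations\<close>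

definition comb_Cauchy :: "(nat \<Rightarrow> (complex \<times> 'x) list) \<Rightarrow> bool" where
  "comb_Cauchy a \<longleftrightarrow> (\<forall>n. a n \<in> comb) \<and>
     (\<forall>e>0. \<exists>k. \<forall>m\<ge>k. \<forall>n\<ge>k. qform (comb_diff (a m) (a n)) < e)"

lemma comb_Cauchy_comb: "comb_Cauchy a \<Longrightarrow> a n \<in> comb"
  by (simp add: comb_Cauchy_def)

lemma comb_Cauchy_const: "l \<in> comb \<Longrightarrow> comb_Cauchy (\<lambda>_. l)"
  by (auto simp: comb_Cauchy_def)

lemma comb_Cauchy_bound:
  assumes "comb_Cauchy a"
  obtains C where "C > 0" "\<forall>\<^sub>F n in sequentially. qform (a n) \<le> C"
proof -
  obtain k where k: "\<forall>m\<ge>k. \<forall>n\<ge>k. qform (comb_diff (a m) (a n)) < 1"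
    using assms unfolding comb_Cauchy_def by (meson zero_less_one)
  have "qform (a n) \<le> 2 + 2 * qform (a k)" if "n \<ge> k" for n
    \<comment> \<open>The empty list is the zero vector: \<open>comb_diff l []\<close> is
      \<open>l\<close> itself.\<close>
    using qform_diff_triangle[of "a n" "a k" "[]"] comb_Cauchy_comb[OF assms] k that
    by (fastforce simp: comb_diff_def comb_scale_def)
  moreover have "2 + 2 * qform (a k) > 0"
    using qform_nonneg[OF comb_Cauchy_comb[OF assms, of k]] by linarith
  ultimately show thesis
    by (intro that[of "2 + 2 * qform (a k)"]) (auto simp: eventually_sequentially)
qed

text \<open>Cauchy-Schwarz bounds the squared modulus by \<open>qform (a n) * C\<close>; conjugation
  gives the second statement.\<close>

lemma form_tendsto_0:
  assumes "\<And>n. a n \<in> comb" "\<And>n. b n \<in> comb"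
    and "(\<lambda>n. qform (a n)) \<longlonglongrightarrow> 0" "\<forall>\<^sub>F n in sequentially. qform (b n) \<le> C"
  shows "(\<lambda>n. form (a n) (b n)) \<longlonglongrightarrow> 0" "(\<lambda>n. form (b n) (a n)) \<longlonglongrightarrow> 0"
proof -
  have *: "(\<lambda>n. form (a n) (b n)) \<longlonglongrightarrow> 0"
  proof -
    have "(\<lambda>n. (cmod (form (a n) (b n)))\<^sup>2) \<longlonglongrightarrow> 0"
    proof (rule tendsto_sandwich[of "\<lambda>_. 0" _ _ "\<lambda>n. qform (a n) * C"])
      show "\<forall>\<^sub>F n in sequentially. (cmod (form (a n) (b n)))\<^sup>2 \<le> qform (a n) * C"
        using assms(4)
      proof eventually_elim
        case (elim n)
        then show ?case
          using form_Cauchy_Schwarz[OF assms(1,2)[of n]] assms(1)[of n]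
          by (meson mult_left_mono order_trans qform_nonneg)
      qed
      show "(\<lambda>n. qform (a n) * C) \<longlonglongrightarrow> 0"
        using tendsto_mult_left_zero[OF assms(3)] by simp
    qed auto
    then have "(\<lambda>n. sqrt ((cmod (form (a n) (b n)))\<^sup>2)) \<longlonglongrightarrow> sqrt 0"
      by (rule tendsto_real_sqrt)
    then show ?thesis
      by (simp add: tendsto_norm_zero_iff)
  qed
  then show "(\<lambda>n. form (a n) (b n)) \<longlonglongrightarrow> 0" .
  have "(\<lambda>n. cnj (form (a n) (b n))) \<longlonglongrightarrow> cnj 0"
    using * by (rule tendsto_cnj)
  then show "(\<lambda>n. form (b n) (a n)) \<longlonglongrightarrow> 0"
    by (simp add: form_hermitian[OF assms(1,2)])
qed

lemma form_convergent:
  assumes a: "comb_Cauchy a" and b: "comb_Cauchy b"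
  shows "convergent (\<lambda>n. form (a n) (b n))"
proof -
  obtain C where C: "C > 0" "\<forall>\<^sub>F n in sequentially. qform (a n) \<le> C"
    using comb_Cauchy_bound[OF a] .
  obtain D where D: "D > 0" "\<forall>\<^sub>F n in sequentially. qform (b n) \<le> D"
    using comb_Cauchy_bound[OF b] .
  have "Cauchy (\<lambda>n. form (a n) (b n))"
  proof (rule CauchyI)
    fix e :: real assume e: "e > 0"
    \<comment> \<open>The difference of two values splits into a change of \<open>a\<close> and a
      change of \<open>b\<close>. These tolerances make each part less than \<open>e / 2\<close>
      after Cauchy-Schwarz with the bounds \<open>D\<close> and \<open>C\<close>.\<close>
    define e1 where "e1 = (e / 2)\<^sup>2 / D"
    define e2 where "e2 = (e / 2)\<^sup>2 / C"
    have "e1 > 0" "e2 > 0"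
      using e C D by (auto simp: e1_def e2_def)
    obtain k1 where k1: "\<And>m n. m \<ge> k1 \<Longrightarrow> n \<ge> k1 \<Longrightarrow> qform (comb_diff (a m) (a n)) < e1"
      using a \<open>e1 > 0\<close> unfolding comb_Cauchy_def by meson
    obtain k2 where k2: "\<And>m n. m \<ge> k2 \<Longrightarrow> n \<ge> k2 \<Longrightarrow> qform (comb_diff (b m) (b n)) < e2"
      using b \<open>e2 > 0\<close> unfolding comb_Cauchy_def by meson
    obtain k3 where k3: "\<And>n. n \<ge> k3 \<Longrightarrow> qform (a n) \<le> C"
      using C(2) unfolding eventually_sequentially by auto
    obtain k4 where k4: "\<And>n. n \<ge> k4 \<Longrightarrow> qform (b n) \<le> D"
      using D(2) unfolding eventually_sequentially by auto
    have "cmod (form (a m) (b m) - form (a n) (b n)) < e"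
      if "m \<ge> k1 + k2 + k3 + k4" "n \<ge> k1 + k2 + k3 + k4" for m n
    proof -
      have ab: "a i \<in> comb" "b i \<in> comb" for i
        using a b by (simp_all add: comb_Cauchy_comb)
      have "(cmod (form (comb_diff (a m) (a n)) (b m)))\<^sup>2 \<le> qform (comb_diff (a m) (a n)) * qform (b m)"
        by (rule form_Cauchy_Schwarz) (simp_all add: ab)
      also have "\<dots> \<le> qform (comb_diff (a m) (a n)) * D"
        using that by (intro mult_left_mono k4) (auto simp: ab)
      also have "\<dots> < e1 * D"
        using that \<open>D > 0\<close> by (intro mult_strict_right_mono k1) auto
      also have "\<dots> = (e / 2)\<^sup>2"
        using \<open>D > 0\<close> by (simp add: e1_def)
      finally have 1: "cmod (form (comb_diff (a m) (a n)) (b m)) < e / 2"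
        by (rule power_less_imp_less_base) (use e in simp)
      have "(cmod (form (a n) (comb_diff (b m) (b n))))\<^sup>2 \<le> qform (a n) * qform (comb_diff (b m) (b n))"
        by (rule form_Cauchy_Schwarz) (simp_all add: ab)
      also have "\<dots> \<le> C * qform (comb_diff (b m) (b n))"
        using that by (intro mult_right_mono k3) (auto simp: ab)
      also have "\<dots> < C * e2"
        using that \<open>C > 0\<close> by (intro mult_strict_left_mono k2) auto
      also have "\<dots> = (e / 2)\<^sup>2"
        using \<open>C > 0\<close> by (simp add: e2_def)
      finally have 2: "cmod (form (a n) (comb_diff (b m) (b n))) < e / 2"
        by (rule power_less_imp_less_base) (use e in simp)
      have "form (a m) (b m) - form (a n) (b n)
          = form (comb_diff (a m) (a n)) (b m) + form (a n) (comb_diff (b m) (b n))"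
        by simp
      then show ?thesis
        using norm_triangle_lt[of "form (comb_diff (a m) (a n)) (b m)" "form (a n) (comb_diff (b m) (b n))" e] 1 2
        by simp
    qed
    then show "\<exists>M. \<forall>m\<ge>M. \<forall>n\<ge>M. cmod (form (a m) (b m) - form (a n) (b n)) < e"
      by blast
  qed
  then show ?thesis
    by (rule Cauchy_convergent)
qed

text \<open>Pairing with \<open>[(1, s)]\<close> plays the role of evaluation at \<open>s\<close>,
  and every combination is built from such points by conjugate-linearity in the second
  argument.\<close>

lemma form_pointwise_null:
  assumes "\<And>s. s \<in> A \<Longrightarrow> (\<lambda>n. form (a n) [(1, s)]) \<longlonglongrightarrow> 0" and "l \<in> comb"
  shows "(\<lambda>n. form (a n) l) \<longlonglongrightarrow> 0"
  using assms(2)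
proof (induction l)
  case (Cons p l)
  obtain c s where p: "p = (c, s)" by (cases p)
  have "s \<in> A" "l \<in> comb"
    using Cons.prems by (auto simp: comb_def p)
  have "form (a n) (p # l) = cnj c * form (a n) [(1, s)] + form (a n) l" for n
    using form_scale_right[of "a n" c "[(1, s)]"]
    by (subst form_Cons_right) (simp add: comb_scale_def p)
  moreover have "(\<lambda>n. cnj c * form (a n) [(1, s)] + form (a n) l) \<longlonglongrightarrow> cnj c * 0 + 0"
    using assms(1)[OF \<open>s \<in> A\<close>] Cons.IH[OF \<open>l \<in> comb\<close>] by (intro tendsto_intros)
  ultimately show ?case
    by simp
qed simp

text \<open>
  A Cauchy sequence that vanishes pointwise in the limit is null, so a pointwise limit
  determines the limits of all inner products.
\<close>

lemma qform_pointwise_null: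
  assumes a: "comb_Cauchy a" and lim: "\<And>s. s \<in> A \<Longrightarrow> (\<lambda>n. form (a n) [(1, s)]) \<longlonglongrightarrow> 0"
  shows "(\<lambda>n. qform (a n)) \<longlonglongrightarrow> 0"
proof (rule LIMSEQ_I)
  fix e :: real assume e: "e > 0"
  have ab: "a i \<in> comb" for i
    using a by (simp add: comb_Cauchy_comb)
  obtain k where k: "\<And>m n. m \<ge> k \<Longrightarrow> n \<ge> k \<Longrightarrow> qform (comb_diff (a m) (a n)) < e / 4"
    using a e unfolding comb_Cauchy_def by (metis divide_pos_pos zero_less_numeral)
  have "(\<lambda>n. form (a n) (a k)) \<longlonglongrightarrow> 0"
    using form_pointwise_null lim ab by blast
  then obtain k' where k': "\<And>n. n \<ge> k' \<Longrightarrow> cmod (form (a n) (a k)) < e / 4"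
    using LIMSEQ_D[of _ 0 "e / 4"] e by auto
  have "norm (qform (a n) - 0) < e" if "n \<ge> k + k'" for n
  proof -
    \<comment> \<open>Solved for \<open>qform (a n)\<close>, the term \<open>qform (a k)\<close> has
      a favourable sign, so \<open>qform (a n)\<close> is less than \<open>e / 4\<close> plus twice
      \<open>e / 4\<close>.\<close>
    have "qform (comb_diff (a n) (a k)) = qform (a n) + qform (a k) - 2 * Re (form (a n) (a k))"
      using form_hermitian[of "a n" "a k"] ab by (simp add: qform_def)
    moreover have "qform (comb_diff (a n) (a k)) < e / 4" "cmod (form (a n) (a k)) < e / 4"
      using k[of n k] k'[of n] that by simp_all
    moreover have "Re (form (a n) (a k)) \<le> cmod (form (a n) (a k))"
      by (rule complex_Re_le_cmod)
    ultimately show ?thesis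
      using qform_nonneg[OF ab[of n]] qform_nonneg[OF ab[of k]] e unfolding real_norm_def by linarith
  qed
  then show "\<exists>no. \<forall>n\<ge>no. norm (qform (a n) - 0) < e"
    by blast
qed

section \<open>The completion as a space of functions\<close>

text \<open>The function records the inner products of the limit vector with all points. The value 0
  off \<open>A\<close> makes it unique, so equality of vectors becomes equality of
  functions.\<close>

definition represents :: "(nat \<Rightarrow> (complex \<times> 'x) list) \<Rightarrow> ('x \<Rightarrow> complex) \<Rightarrow> bool" where
  "represents a F \<longleftrightarrow> comb_Cauchy a \<and> (\<forall>s\<in>A. (\<lambda>n. form (a n) [(1, s)]) \<longlonglongrightarrow> F s) \<and> (\<forall>s. s \<notin> A \<longrightarrow> F s = 0)"

lemma represents_comb: "represents a F \<Longrightarrow> a n \<in> comb"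
  by (simp add: represents_def comb_Cauchy_comb)

lemma represents_add:
  assumes "represents a F" "represents b G"
  shows "represents (\<lambda>n. a n @ b n) (\<lambda>s. F s + G s)"
proof -
  have "comb_Cauchy (\<lambda>n. a n @ b n)"
    unfolding comb_Cauchy_def
  proof (intro conjI allI impI)
    fix n show "a n @ b n \<in> comb"
      using assms by (simp add: represents_comb)
  next
    fix e :: real assume "e > 0"
    then have "e / 4 > 0" by simp
    then obtain k k' where k: "\<And>m n. m \<ge> k \<Longrightarrow> n \<ge> k \<Longrightarrow> qform (comb_diff (a m) (a n)) < e / 4"
      and k': "\<And>m n. m \<ge> k' \<Longrightarrow> n \<ge> k' \<Longrightarrow> qform (comb_diff (b m) (b n)) < e / 4"
      using assms unfolding represents_def comb_Cauchy_def by meson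
    have "qform (comb_diff (a m @ b m) (a n @ b n)) < e" if "m \<ge> k + k'" "n \<ge> k + k'" for m n
    proof -
      have "qform (comb_diff (a m @ b m) (a n @ b n)) = qform (comb_diff (a m) (a n) @ comb_diff (b m) (b n))"
        by (simp add: qform_def)
      also have "\<dots> \<le> 2 * qform (comb_diff (a m) (a n)) + 2 * qform (comb_diff (b m) (b n))"
      proof -
        have "0 \<le> qform (comb_diff (comb_diff (a m) (a n)) (comb_diff (b m) (b n)))"
          by (simp add: assms[THEN represents_comb])
        then show ?thesis
          using qform_parallelogram[of "comb_diff (a m) (a n)" "comb_diff (b m) (b n)"] by linarith
      qed
      also have "\<dots> < e"
        using k[of m n] k'[of m n] that by simp
      finally show ?thesis .
    qed
    then show "\<exists>k. \<forall>m\<ge>k. \<forall>n\<ge>k. qform (comb_diff (a m @ b m) (a n @ b n)) < e"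
      by blast
  qed
  then show ?thesis
    using assms by (auto simp: represents_def intro: tendsto_add)
qed

lemma represents_scale:
  assumes "represents a F"
  shows "represents (\<lambda>n. comb_scale c (a n)) (\<lambda>s. c * F s)"
proof -
  have *: "qform (comb_diff (comb_scale c l) (comb_scale c m)) = (cmod c)\<^sup>2 * qform (comb_diff l m)"
    if "l \<in> comb" "m \<in> comb" for l m
  proof -
    have "form (comb_diff (comb_scale c l) (comb_scale c m)) (comb_diff (comb_scale c l) (comb_scale c m))
        = (c * cnj c) * form (comb_diff l m) (comb_diff l m)"
      by (simp add: algebra_simps)
    also have "\<dots> = of_real ((cmod c)\<^sup>2 * qform (comb_diff l m))"
      unfolding complex_norm_square [symmetric] using that by (simp add: form_self del: form_diff)
    finally show ?thesis
      by (simp add: qform_def)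
  qed
  have "comb_Cauchy (\<lambda>n. comb_scale c (a n))"
    unfolding comb_Cauchy_def
  proof (intro conjI allI impI)
    fix n show "comb_scale c (a n) \<in> comb"
      using assms by (simp add: represents_comb)
  next
    fix e :: real assume "e > 0"
    \<comment> \<open>One is added to keep the divisor positive for \<open>c = 0\<close>.\<close>
    have pos: "(cmod c)\<^sup>2 + 1 > 0"
      using zero_le_power2[of "cmod c"] by linarith
    then have "e / ((cmod c)\<^sup>2 + 1) > 0"
      using \<open>e > 0\<close> by simp
    then obtain k where k: "\<And>m n. m \<ge> k \<Longrightarrow> n \<ge> k \<Longrightarrow> qform (comb_diff (a m) (a n)) < e / ((cmod c)\<^sup>2 + 1)"
      using assms unfolding represents_def comb_Cauchy_def by meson
    have "qform (comb_diff (comb_scale c (a m)) (comb_scale c (a n))) < e" if "m \<ge> k" "n \<ge> k" for m n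
    proof -
      have "(cmod c)\<^sup>2 * qform (comb_diff (a m) (a n)) \<le> ((cmod c)\<^sup>2 + 1) * qform (comb_diff (a m) (a n))"
        using assms by (intro mult_right_mono) (auto simp: represents_comb)
      also have "\<dots> < e"
        using k[OF that] pos by (simp add: field_simps)
      finally show ?thesis
        using assms by (simp add: * represents_comb)
    qed
    then show "\<exists>k. \<forall>m\<ge>k. \<forall>n\<ge>k. qform (comb_diff (comb_scale c (a m)) (comb_scale c (a n))) < e"
      by blast
  qed
  then show ?thesis
    using assms by (auto simp: represents_def intro: tendsto_mult_left)
qed

lemma represents_diff:
  assumes "represents a F" "represents b G"
  shows "represents (\<lambda>n. comb_diff (a n) (b n)) (\<lambda>s. F s - G s)"
  using represents_add[OF assms(1) represents_scale[OF assms(2), of "-1"]]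
  by (simp add: comb_diff_def)

text \<open>The difference sequence represents the zero function and is therefore null. This makes
  the inner product on functions well defined.\<close>

lemma represents_unique:
  assumes "represents a F" "represents b F"
  shows "(\<lambda>n. qform (comb_diff (a n) (b n))) \<longlonglongrightarrow> 0"
  using represents_diff[OF assms] by (intro qform_pointwise_null) (auto simp: represents_def)

text \<open>Combinations of the kernel sections \<open>K t\<close>: the dense subspace of the
  completion.\<close>

definition comb_fun :: "(complex \<times> 'x) list \<Rightarrow> 'x \<Rightarrow> complex" where
  "comb_fun l s = (if s \<in> A then form l [(1, s)] else 0)"

lemma represents_comb_fun: "l \<in> comb \<Longrightarrow> represents (\<lambda>_. l) (comb_fun l)"
  by (simp add: represents_def comb_Cauchy_const comb_fun_def)

text \<open>Evaluation is pairing with a constant Cauchy sequence, so \<open>form_convergent\<close>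
  supplies the pointwise limits.\<close>

lemma represents_lim:
  assumes "comb_Cauchy a"
  obtains F where "represents a F"
proof
  define F where "F s = (if s \<in> A then lim (\<lambda>n. form (a n) [(1, s)]) else 0)" for s
  show "represents a F"
    using assms form_convergent[OF assms comb_Cauchy_const[OF comb_point]]
    by (auto simp: represents_def F_def convergent_LIMSEQ_iff)
qed

definition rep_of :: "('x \<Rightarrow> complex) \<Rightarrow> nat \<Rightarrow> (complex \<times> 'x) list" where
  "rep_of F = (SOME a. represents a F)"

text \<open>The reproducing kernel Hilbert space of \<open>K\<close>. Its inner product is computed
  from chosen sequences; \<open>cinner_rkhs\<close> frees it from the choice.\<close>

definition rkhs :: "('x \<Rightarrow> complex) hilbert" where
  "rkhs = \<lparr>carrier = {F. \<exists>a. represents a F}, monoid.mult = (\<lambda>F G. F), monoid.one = (\<lambda>_. 0),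
     ring.zero = (\<lambda>_. 0), ring.add = (\<lambda>F G s. F s + G s), smult = (\<lambda>c F s. c * F s),
     cinner = (\<lambda>F G. lim (\<lambda>n. form (rep_of F n) (rep_of G n)))\<rparr>"

lemma rkhs_simps:
  "ring.zero rkhs = (\<lambda>_. 0)" "ring.add rkhs F G = (\<lambda>s. F s + G s)" "smult rkhs c F = (\<lambda>s. c * F s)"
  by (simp_all add: rkhs_def)

lemma rkhs_carrierI: "represents a F \<Longrightarrow> F \<in> carrier rkhs"
  by (auto simp: rkhs_def)

lemma rkhs_carrierE:
  assumes "F \<in> carrier rkhs" obtains a where "represents a F"
  using assms by (auto simp: rkhs_def)

text \<open>Passing from the chosen sequences to \<open>a\<close> and \<open>b\<close> adds two
  terms, each containing a difference of two sequences for the same function. Such differences are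
  null and the other arguments are bounded.\<close>

lemma cinner_rkhs:
  assumes a: "represents a F" and b: "represents b G"
  shows "(\<lambda>n. form (a n) (b n)) \<longlonglongrightarrow> cinner rkhs F G"
proof -
  have a': "represents (rep_of F) F" and b': "represents (rep_of G) G"
    using someI[of "\<lambda>a. represents a F", OF a] someI[of "\<lambda>a. represents a G", OF b] by (simp_all add: rep_of_def)
  have lim: "(\<lambda>n. form (rep_of F n) (rep_of G n)) \<longlonglongrightarrow> cinner rkhs F G"
    using form_convergent[of "rep_of F" "rep_of G"] a' b'
    by (simp add: rkhs_def convergent_LIMSEQ_iff represents_def)
  obtain C where C: "\<forall>\<^sub>F n in sequentially. qform (a n) \<le> C"
    using comb_Cauchy_bound a unfolding represents_def by metis
  obtain D where D: "\<forall>\<^sub>F n in sequentially. qform (rep_of G n) \<le> D"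
    using comb_Cauchy_bound b' unfolding represents_def by metis
  have "(\<lambda>n. form (comb_diff (a n) (rep_of F n)) (rep_of G n)) \<longlonglongrightarrow> 0"
    using represents_unique[OF a a'] D by (rule form_tendsto_0(1)[rotated 2]) (auto intro: comb_diff_comb represents_comb a a' b')
  moreover have "(\<lambda>n. form (a n) (comb_diff (b n) (rep_of G n))) \<longlonglongrightarrow> 0"
    using represents_unique[OF b b'] C by (rule form_tendsto_0(2)[rotated 2]) (auto intro: comb_diff_comb represents_comb a b b')
  ultimately have "(\<lambda>n. form (rep_of F n) (rep_of G n) + (form (comb_diff (a n) (rep_of F n)) (rep_of G n)
      + form (a n) (comb_diff (b n) (rep_of G n)))) \<longlonglongrightarrow> cinner rkhs F G + (0 + 0)"
    using lim by (intro tendsto_add)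
  then show ?thesis
    by (simp add: algebra_simps)
qed

lemma cinner_rkhs_eqI:
  assumes "represents a F" "represents b G" "(\<lambda>n. form (a n) (b n)) \<longlonglongrightarrow> z"
  shows "cinner rkhs F G = z"
  using cinner_rkhs[OF assms(1,2)] assms(3) by (rule LIMSEQ_unique)

lemma qform_tendsto:
  assumes "represents a F"
  shows "(\<lambda>n. qform (a n)) \<longlonglongrightarrow> Re (cinner rkhs F F)"
  unfolding qform_def by (intro tendsto_Re cinner_rkhs assms)

lemma Re_cinner_rkhs_nonneg:
  assumes "F \<in> carrier rkhs"
  shows "0 \<le> Re (cinner rkhs F F)"
proof -
  obtain a where a: "represents a F"
    using assms by (rule rkhs_carrierE)
  show ?thesis
    using qform_tendsto[OF a] by (rule LIMSEQ_le_const) (auto simp: represents_comb[OF a])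
qed

lemma hnorm_rkhs_sqr: "F \<in> carrier rkhs \<Longrightarrow> (hnorm rkhs F)\<^sup>2 = Re (cinner rkhs F F)"
  by (simp add: hnorm_def Re_cinner_rkhs_nonneg)

lemma qform_tendsto_hnorm:
  assumes "represents a F"
  shows "(\<lambda>n. qform (a n)) \<longlonglongrightarrow> (hnorm rkhs F)\<^sup>2"
  using qform_tendsto[OF assms] hnorm_rkhs_sqr[OF rkhs_carrierI[OF assms]] by simp

section \<open>Hilbert space axioms: addition, definiteness, completeness\<close>

lemma abelian_group_rkhs: "abelian_group rkhs"
proof (rule abelian_groupI)
  fix F G assume "F \<in> carrier rkhs" "G \<in> carrier rkhs"
  then show "F \<oplus>\<^bsub>rkhs\<^esub> G \<in> carrier rkhs"
    unfolding rkhs_simps by (blast elim: rkhs_carrierE intro: rkhs_carrierI represents_add)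
next
  show "\<zero>\<^bsub>rkhs\<^esub> \<in> carrier rkhs"
    using represents_comb_fun[OF comb_Nil] rkhs_carrierI[of "\<lambda>_. []" "\<lambda>_. 0"]
    by (auto simp: rkhs_simps represents_def comb_fun_def)
next
  fix F assume F: "F \<in> carrier rkhs"
  then obtain a where "represents a F" by (rule rkhs_carrierE)
  then have "(\<lambda>s. -1 * F s) \<in> carrier rkhs"
    by (intro rkhs_carrierI[OF represents_scale])
  then show "\<exists>G\<in>carrier rkhs. G \<oplus>\<^bsub>rkhs\<^esub> F = \<zero>\<^bsub>rkhs\<^esub>"
    by (rule bexI[rotated]) (simp add: rkhs_simps)
qed (simp_all add: rkhs_simps algebra_simps)

lemma rkhs_minus:
  assumes "F \<in> carrier rkhs" "G \<in> carrier rkhs"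
  shows "F \<ominus>\<^bsub>rkhs\<^esub> G = (\<lambda>s. F s - G s)"
proof -
  interpret abelian_group rkhs by (rule abelian_group_rkhs)
  obtain b where "represents b G"
    using assms(2) by (rule rkhs_carrierE)
  then have "(\<lambda>s. -1 * G s) \<in> carrier rkhs"
    by (intro rkhs_carrierI[OF represents_scale])
  then have "(\<lambda>s. - G s) \<in> carrier rkhs"
    by simp
  moreover have "(\<lambda>s. - G s) \<oplus>\<^bsub>rkhs\<^esub> G = \<zero>\<^bsub>rkhs\<^esub>"
    by (simp add: rkhs_simps)
  ultimately have "\<ominus>\<^bsub>rkhs\<^esub> G = (\<lambda>s. - G s)"
    using assms(2) by (simp add: minus_equality)
  then show ?thesis
    by (simp add: a_minus_def rkhs_simps)
qed

lemma rkhs_diff_closed: "F \<in> carrier rkhs \<Longrightarrow> G \<in> carrier rkhs \<Longrightarrow> (\<lambda>s. F s - G s) \<in> carrier rkhs"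
  by (blast elim: rkhs_carrierE intro: rkhs_carrierI represents_diff)

lemma hnorm_rkhs_diff_triangle:
  assumes "F \<in> carrier rkhs" "G \<in> carrier rkhs" "J \<in> carrier rkhs"
  shows "(hnorm rkhs (\<lambda>s. F s - J s))\<^sup>2 \<le> 2 * (hnorm rkhs (\<lambda>s. F s - G s))\<^sup>2 + 2 * (hnorm rkhs (\<lambda>s. G s - J s))\<^sup>2"
proof -
  obtain a b c where r: "represents a F" "represents b G" "represents c J"
    using assms by (blast elim: rkhs_carrierE)
  note lim = represents_diff[THEN qform_tendsto_hnorm]
  show ?thesis
  proof (rule LIMSEQ_le[OF lim[OF r(1,3)] tendsto_add[OF tendsto_mult_left[OF lim[OF r(1,2)]] tendsto_mult_left[OF lim[OF r(2,3)]]]])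
    show "\<exists>N. \<forall>n\<ge>N. qform (comb_diff (a n) (c n)) \<le> 2 * qform (comb_diff (a n) (b n)) + 2 * qform (comb_diff (b n) (c n))"
      using r by (intro exI allI impI qform_diff_triangle) (auto intro: represents_comb)
  qed
qed

lemma hnorm_rkhs_diff_sym:
  assumes "F \<in> carrier rkhs" "G \<in> carrier rkhs"
  shows "hnorm rkhs (\<lambda>s. F s - G s) = hnorm rkhs (\<lambda>s. G s - F s)"
proof -
  obtain a b where r: "represents a F" "represents b G"
    using assms by (blast elim: rkhs_carrierE)
  have "(hnorm rkhs (\<lambda>s. F s - G s))\<^sup>2 = (hnorm rkhs (\<lambda>s. G s - F s))\<^sup>2"
    using qform_tendsto_hnorm[OF represents_diff[OF r]] qform_tendsto_hnorm[OF represents_diff[OF r(2,1)]]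
    by (simp add: LIMSEQ_unique qform_diff_sym)
  then show ?thesis
    using rkhs_diff_closed assms Re_cinner_rkhs_nonneg by (simp add: hnorm_def)
qed

text \<open>If the norm vanishes, Cauchy-Schwarz makes the pairings with all points tend to 0, so
  the function itself is 0: no quotient by null vectors has to be formed.\<close>

lemma rkhs_pos:
  assumes "F \<in> carrier rkhs" "F \<noteq> (\<lambda>_. 0)"
  shows "0 < Re (cinner rkhs F F)"
proof (rule ccontr)
  obtain a where a: "represents a F"
    using assms(1) by (rule rkhs_carrierE)
  assume "\<not> 0 < Re (cinner rkhs F F)"
  then have q: "(\<lambda>n. qform (a n)) \<longlonglongrightarrow> 0"
    using qform_tendsto[OF a] Re_cinner_rkhs_nonneg[OF assms(1)] by simp
  have "F s = 0" for s
  proof (cases "s \<in> A")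
    case True
    have "(\<lambda>n. form (a n) [(1, s)]) \<longlonglongrightarrow> 0"
      using q by (rule form_tendsto_0(1)[rotated 2, where C = "qform [(1, s)]"]) (use True a represents_comb in auto)
    then show ?thesis
      using a True by (auto simp: represents_def intro: LIMSEQ_unique)
  qed (use a in \<open>simp add: represents_def\<close>)
  then show False
    using assms(2) by auto
qed

text \<open>A late term of a representing sequence, read as a constant sequence, is close to the
  limit.\<close>

lemma rkhs_approx:
  assumes "F \<in> carrier rkhs" "e > 0"
  obtains l where "l \<in> comb" "(hnorm rkhs (\<lambda>s. F s - comb_fun l s))\<^sup>2 < e"
proof -
  obtain a where a: "represents a F"
    using assms(1) by (rule rkhs_carrierE)
  obtain k where k: "\<And>m n. m \<ge> k \<Longrightarrow> n \<ge> k \<Longrightarrow> qform (comb_diff (a m) (a n)) < e / 2"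
    using a assms(2) unfolding represents_def comb_Cauchy_def by (metis half_gt_zero)
  have lim: "(\<lambda>n. qform (comb_diff (a n) (a k))) \<longlonglongrightarrow> (hnorm rkhs (\<lambda>s. F s - comb_fun (a k) s))\<^sup>2"
    using qform_tendsto_hnorm[OF represents_diff[OF a represents_comb_fun[OF represents_comb[OF a]]]] .
  have "(hnorm rkhs (\<lambda>s. F s - comb_fun (a k) s))\<^sup>2 \<le> e / 2"
    using lim by (rule LIMSEQ_le_const2) (use k in \<open>auto intro!: exI[of _ k] less_imp_le\<close>)
  then show thesis
    using assms(2) a by (intro that[of "a k"]) (auto intro: represents_comb)
qed

lemma hnorm_comb_fun_diff:
  assumes "l \<in> comb" "m \<in> comb"
  shows "(hnorm rkhs (\<lambda>s. comb_fun l s - comb_fun m s))\<^sup>2 = qform (comb_diff l m)"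
  using qform_tendsto_hnorm[OF represents_diff[OF represents_comb_fun[OF assms(1)] represents_comb_fun[OF assms(2)]]]
  by (simp add: LIMSEQ_const_iff)

text \<open>Each \<open>u n\<close> is replaced by a combination \<open>b n\<close> at squared
  distance less than \<open>1 / Suc n\<close>. The sequence \<open>b\<close> is again Cauchy, and
  the function that it represents is the limit.\<close>

lemma rkhs_complete:
  assumes u: "\<And>n. u n \<in> carrier rkhs"
    and Cauchy: "\<And>e. e > 0 \<Longrightarrow> \<exists>k. \<forall>m\<ge>k. \<forall>n\<ge>k. hnorm rkhs (\<lambda>s. u m s - u n s) < e"
  obtains F where "F \<in> carrier rkhs" "(\<lambda>n. hnorm rkhs (\<lambda>s. u n s - F s)) \<longlonglongrightarrow> 0"
proof -
  have "\<exists>l\<in>comb. (hnorm rkhs (\<lambda>s. u n s - comb_fun l s))\<^sup>2 < 1 / Suc n" for n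
    using rkhs_approx[OF u[of n], of "1 / Suc n"] by auto
  then obtain b where b: "\<And>n. b n \<in> comb"
    and ub: "\<And>n. (hnorm rkhs (\<lambda>s. u n s - comb_fun (b n) s))\<^sup>2 < 1 / Suc n"
    by metis
  have bc: "comb_fun (b n) \<in> carrier rkhs" for n
    using b by (intro rkhs_carrierI[OF represents_comb_fun])
  have "comb_Cauchy b"
    unfolding comb_Cauchy_def
  proof (intro conjI allI impI b)
    fix e :: real assume e: "e > 0"
    \<comment> \<open>Twelfths suffice: two doubled triangle inequalities, from \<open>b m\<close>
      over \<open>u m\<close> and \<open>u n\<close> to \<open>b n\<close>, give the weights 2, 4
      and 4.\<close>
    obtain k where k: "\<And>m n. m \<ge> k \<Longrightarrow> n \<ge> k \<Longrightarrow> hnorm rkhs (\<lambda>s. u m s - u n s) < sqrt (e / 12)"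
      using Cauchy[of "sqrt (e / 12)"] e by auto
    obtain k' :: nat where k': "1 / Suc k' < e / 12"
      using e by (meson nat_approx_posE divide_pos_pos zero_less_numeral)
    have small: "(hnorm rkhs (\<lambda>s. u n s - comb_fun (b n) s))\<^sup>2 < e / 12" if "n \<ge> k'" for n
    proof -
      have "1 / real (Suc n) \<le> 1 / real (Suc k')"
        using that by (intro divide_left_mono) auto
      then show ?thesis
        using ub[of n] k' by linarith
    qed
    have "qform (comb_diff (b m) (b n)) < e" if "m \<ge> k + k'" "n \<ge> k + k'" for m n
    proof -
      have 1: "(hnorm rkhs (\<lambda>s. comb_fun (b m) s - u m s))\<^sup>2 < e / 12"
        using small[of m] that by (simp add: hnorm_rkhs_diff_sym[OF bc u])
      have 2: "(hnorm rkhs (\<lambda>s. u n s - comb_fun (b n) s))\<^sup>2 < e / 12"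
        using small[of n] that by simp
      have "(hnorm rkhs (\<lambda>s. u m s - u n s))\<^sup>2 < (sqrt (e / 12))\<^sup>2"
        using k[of m n] that by (intro power_strict_mono) (auto simp: hnorm_def Re_cinner_rkhs_nonneg rkhs_diff_closed u)
      then have 3: "(hnorm rkhs (\<lambda>s. u m s - u n s))\<^sup>2 < e / 12"
        using e by simp
      show ?thesis
        using hnorm_rkhs_diff_triangle[OF bc[of m] u[of m] bc[of n]] hnorm_rkhs_diff_triangle[OF u[of m] u[of n] bc[of n]]
          1 2 3 e hnorm_comb_fun_diff[OF b[of m] b[of n]] by linarith
    qed
    then show "\<exists>k. \<forall>m\<ge>k. \<forall>n\<ge>k. qform (comb_diff (b m) (b n)) < e"
      by blast
  qed
  then obtain F where F: "represents b F"
    by (rule represents_lim)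
  have Fc: "F \<in> carrier rkhs"
    using F by (rule rkhs_carrierI)
  have bF: "(\<lambda>n. (hnorm rkhs (\<lambda>s. comb_fun (b n) s - F s))\<^sup>2) \<longlonglongrightarrow> 0"
  proof (rule LIMSEQ_I)
    fix e :: real assume e: "e > 0"
    obtain k where k: "\<And>m n. m \<ge> k \<Longrightarrow> n \<ge> k \<Longrightarrow> qform (comb_diff (b m) (b n)) < e / 2"
      using \<open>comb_Cauchy b\<close> e unfolding comb_Cauchy_def by (metis half_gt_zero)
    have "norm ((hnorm rkhs (\<lambda>s. comb_fun (b n) s - F s))\<^sup>2 - 0) < e" if "n \<ge> k" for n
    proof -
      \<comment> \<open>The distance from \<open>b n\<close> to \<open>F\<close> is a limit over
        \<open>j\<close>, so the Cauchy estimate passes to it in the non-strict form.\<close>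
      have "(\<lambda>j. qform (comb_diff (b n) (b j))) \<longlonglongrightarrow> (hnorm rkhs (\<lambda>s. comb_fun (b n) s - F s))\<^sup>2"
        using qform_tendsto_hnorm[OF represents_diff[OF represents_comb_fun[OF b] F]] .
      then have "(hnorm rkhs (\<lambda>s. comb_fun (b n) s - F s))\<^sup>2 \<le> e / 2"
        by (rule LIMSEQ_le_const2) (use k that in \<open>auto intro!: exI[of _ k] less_imp_le\<close>)
      then show ?thesis
        using e by simp
    qed
    then show "\<exists>no. \<forall>n\<ge>no. norm ((hnorm rkhs (\<lambda>s. comb_fun (b n) s - F s))\<^sup>2 - 0) < e"
      by blast
  qed
  have "(\<lambda>n. (hnorm rkhs (\<lambda>s. u n s - F s))\<^sup>2) \<longlonglongrightarrow> 0"
  proof (rule tendsto_sandwich[of "\<lambda>_. 0"])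
    show "\<forall>\<^sub>F n in sequentially. (hnorm rkhs (\<lambda>s. u n s - F s))\<^sup>2
        \<le> 2 * (1 / Suc n) + 2 * (hnorm rkhs (\<lambda>s. comb_fun (b n) s - F s))\<^sup>2"
    proof (intro always_eventually allI)
      fix n show "(hnorm rkhs (\<lambda>s. u n s - F s))\<^sup>2
        \<le> 2 * (1 / Suc n) + 2 * (hnorm rkhs (\<lambda>s. comb_fun (b n) s - F s))\<^sup>2"
        using hnorm_rkhs_diff_triangle[OF u[of n] bc[of n] Fc] ub[of n] by linarith
    qed
    have "(\<lambda>n. 2 * (1 / real (Suc n)) + 2 * (hnorm rkhs (\<lambda>s. comb_fun (b n) s - F s))\<^sup>2) \<longlonglongrightarrow> 2 * 0 + 2 * 0"
      using bF LIMSEQ_inverse_real_of_nat unfolding inverse_eq_divide by (intro tendsto_intros)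
    then show "(\<lambda>n. 2 * (1 / real (Suc n)) + 2 * (hnorm rkhs (\<lambda>s. comb_fun (b n) s - F s))\<^sup>2) \<longlonglongrightarrow> 0"
      by simp
  qed auto
  then have "(\<lambda>n. sqrt ((hnorm rkhs (\<lambda>s. u n s - F s))\<^sup>2)) \<longlonglongrightarrow> sqrt 0"
    by (rule tendsto_real_sqrt)
  then have "(\<lambda>n. hnorm rkhs (\<lambda>s. u n s - F s)) \<longlonglongrightarrow> 0"
    by (simp add: tendsto_rabs_zero_iff)
  then show thesis
    using Fc that by blast
qed

lemma hilbert_space_rkhs: "hilbert_space rkhs"
  unfolding hilbert_space_def
proof (intro conjI ballI allI impI)
  show "module (ring_of_type_algebra :: complex ring) rkhs"
  proof (rule moduleI)
    fix c F assume "F \<in> carrier rkhs"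
    then show "c \<odot>\<^bsub>rkhs\<^esub> F \<in> carrier rkhs"
      unfolding rkhs_simps by (blast elim: rkhs_carrierE intro: rkhs_carrierI represents_scale)
  qed (auto simp: rkhs_simps algebra_simps ring_of_type_algebra_def abelian_group_rkhs
      intro: cring_from_type_algebra[unfolded ring_of_type_algebra_def])
next
  fix F G J assume "F \<in> carrier rkhs" "G \<in> carrier rkhs" "J \<in> carrier rkhs"
  then obtain a b c where r: "represents a F" "represents b G" "represents c J"
    by (blast elim: rkhs_carrierE)
  show "cinner rkhs (F \<oplus>\<^bsub>rkhs\<^esub> G) J = cinner rkhs F J + cinner rkhs G J"
    unfolding rkhs_simps
    by (rule cinner_rkhs_eqI[OF represents_add[OF r(1,2)] r(3)]) (use r in \<open>auto intro: tendsto_add cinner_rkhs\<close>)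
next
  fix z F G assume "F \<in> carrier rkhs" "G \<in> carrier rkhs"
  then obtain a b where r: "represents a F" "represents b G"
    by (blast elim: rkhs_carrierE)
  show "cinner rkhs (z \<odot>\<^bsub>rkhs\<^esub> F) G = z * cinner rkhs F G"
    unfolding rkhs_simps
    by (rule cinner_rkhs_eqI[OF represents_scale[OF r(1)] r(2)]) (use r in \<open>auto intro: tendsto_mult_left cinner_rkhs\<close>)
next
  fix F G assume "F \<in> carrier rkhs" "G \<in> carrier rkhs"
  then obtain a b where r: "represents a F" "represents b G"
    by (blast elim: rkhs_carrierE)
  have "(\<lambda>n. cnj (form (a n) (b n))) \<longlonglongrightarrow> cnj (cinner rkhs F G)"
    by (intro tendsto_cnj cinner_rkhs r)
  then have "(\<lambda>n. form (b n) (a n)) \<longlonglongrightarrow> cnj (cinner rkhs F G)"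
    by (simp add: form_hermitian[OF represents_comb[OF r(1)] represents_comb[OF r(2)]])
  then show "cinner rkhs G F = cnj (cinner rkhs F G)"
    by (rule cinner_rkhs_eqI[OF r(2,1)])
next
  fix F assume "F \<in> carrier rkhs" "F \<noteq> \<zero>\<^bsub>rkhs\<^esub>"
  then show "0 < Re (cinner rkhs F F)"
    by (intro rkhs_pos) (auto simp: rkhs_simps)
next
  fix u :: "nat \<Rightarrow> 'x \<Rightarrow> complex"
  assume "\<forall>n. u n \<in> carrier rkhs"
    and "\<forall>e>0. \<exists>k. \<forall>m\<ge>k. \<forall>n\<ge>k. hnorm rkhs (u m \<ominus>\<^bsub>rkhs\<^esub> u n) < e"
  then obtain F where "F \<in> carrier rkhs" "(\<lambda>n. hnorm rkhs (\<lambda>s. u n s - F s)) \<longlonglongrightarrow> 0"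
    by (auto simp: rkhs_minus intro: rkhs_complete[of u])
  then show "\<exists>F\<in>carrier rkhs. (\<lambda>n. hnorm rkhs (u n \<ominus>\<^bsub>rkhs\<^esub> F)) \<longlonglongrightarrow> 0"
    using \<open>\<forall>n. u n \<in> carrier rkhs\<close> by (auto simp: rkhs_minus intro!: bexI[of _ F])
qed

end

section \<open>Property (T) and positive definite functions\<close>

definition comb_translate :: "('g, 'm) monoid_scheme \<Rightarrow> 'g \<Rightarrow> (complex \<times> 'g) list \<Rightarrow> (complex \<times> 'g) list" where
  "comb_translate G g = map (\<lambda>(c, s). (c, g \<otimes>\<^bsub>G\<^esub> s))"

text \<open>The kernel \<open>\<phi> (inv t \<otimes> s)\<close> does not change when both points
  are translated from the left; this makes left translation unitary.\<close>

locale pos_def_function = group G for G (structure) +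
  fixes \<phi> :: "'a \<Rightarrow> complex"
  assumes pos_def_kernel: "pos_def_kernel (carrier G) (\<lambda>s t. \<phi> (inv t \<otimes> s))"

sublocale pos_def_function \<subseteq> pos_def_kernel "carrier G" "\<lambda>s t. \<phi> (inv t \<otimes> s)"
  by (rule pos_def_kernel)

context pos_def_function
begin

section \<open>The GNS representation by left translation\<close>

abbreviation translate where "translate \<equiv> comb_translate G"

lemma translate_comb [simp]: "g \<in> carrier G \<Longrightarrow> l \<in> comb \<Longrightarrow> translate g l \<in> comb"
  by (force simp: comb_def comb_translate_def)

lemma form_translate [simp]:
  assumes g: "g \<in> carrier G" and "l \<in> comb" "m \<in> comb"
  shows "form (translate g l) (translate g m) = form l m"
proof -
  have K: "inv (g \<otimes> t) \<otimes> (g \<otimes> s) = inv t \<otimes> s" if "s \<in> carrier G" "t \<in> carrier G" for s t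
  proof -
    have "inv g \<otimes> (g \<otimes> s) = s"
      using that g by (simp add: m_assoc [symmetric])
    then show ?thesis
      using that g by (simp add: inv_mult_group m_assoc)
  qed
  have "snd x \<in> carrier G" if "x \<in> set l \<union> set m" for x
    using assms(2,3) that by (auto simp: comb_def)
  then show ?thesis
    unfolding kernel_form_def comb_translate_def
    by (auto simp: case_prod_unfold o_def K cong: map_cong)
qed

lemma comb_diff_translate: "comb_diff (translate g l) (translate g m) = translate g (comb_diff l m)"
  by (simp add: comb_diff_def comb_scale_def comb_translate_def case_prod_unfold)

lemma qform_translate: "g \<in> carrier G \<Longrightarrow> l \<in> comb \<Longrightarrow> qform (translate g l) = qform l"
  by (simp add: qform_def)

text \<open>The value 0 off the carrier is the one that \<open>represents\<close> demands.\<close>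

definition lreg :: "'a \<Rightarrow> ('a \<Rightarrow> complex) \<Rightarrow> 'a \<Rightarrow> complex" where
  "lreg g F s = (if s \<in> carrier G then F (inv g \<otimes> s) else 0)"

text \<open>The point \<open>[(1, s)]\<close> is the translate of
  \<open>[(1, inv g \<otimes> s)]\<close>, and the form is invariant under translation.\<close>

lemma represents_lreg:
  assumes "represents a F" "g \<in> carrier G"
  shows "represents (\<lambda>n. translate g (a n)) (lreg g F)"
proof -
  have "form (translate g (a n)) [(1, s)] = form (a n) [(1, inv g \<otimes> s)]" if "s \<in> carrier G" for n s
  proof -
    have "[(1, s)] = translate g [(1, inv g \<otimes> s)]"
      using assms(2) that by (simp add: comb_translate_def m_assoc [symmetric])
    then show ?thesis
      using form_translate[OF assms(2) represents_comb[OF assms(1)], of "[(1, inv g \<otimes> s)]" n] assms(2) that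
      by simp
  qed
  then show ?thesis
    using assms represents_comb[OF assms(1)]
    by (auto simp: represents_def comb_Cauchy_def comb_diff_translate qform_translate lreg_def)
qed

lemma lreg_closed: "F \<in> carrier rkhs \<Longrightarrow> g \<in> carrier G \<Longrightarrow> lreg g F \<in> carrier rkhs"
  by (blast elim: rkhs_carrierE intro: rkhs_carrierI represents_lreg)

lemma cinner_lreg:
  assumes "F \<in> carrier rkhs" "F' \<in> carrier rkhs" "g \<in> carrier G"
  shows "cinner rkhs (lreg g F) (lreg g F') = cinner rkhs F F'"
proof -
  obtain a b where r: "represents a F" "represents b F'"
    using assms by (blast elim: rkhs_carrierE)
  show ?thesis
    by (rule cinner_rkhs_eqI[OF r[THEN represents_lreg[OF _ assms(3)]]])
      (use cinner_rkhs[OF r] r assms(3) in \<open>simp add: represents_comb\<close>)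
qed

lemma hnorm_lreg: "F \<in> carrier rkhs \<Longrightarrow> g \<in> carrier G \<Longrightarrow> hnorm rkhs (lreg g F) = hnorm rkhs F"
  by (simp add: hnorm_def cinner_lreg)

lemma lreg_mult: "g \<in> carrier G \<Longrightarrow> h \<in> carrier G \<Longrightarrow> lreg g (lreg h F) = lreg (g \<otimes> h) F"
  by (auto simp: lreg_def fun_eq_iff inv_mult_group m_assoc)

lemma lreg_one: "F \<in> carrier rkhs \<Longrightarrow> lreg \<one> F = F"
  by (auto simp: lreg_def fun_eq_iff represents_def elim: rkhs_carrierE)

lemma lreg_diff: "lreg g (\<lambda>s. F s - F' s) = (\<lambda>s. lreg g F s - lreg g F' s)"
  by (auto simp: lreg_def fun_eq_iff)

lemma lreg_comb_fun:
  assumes "l \<in> comb" "g \<in> carrier G"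
  shows "lreg g (comb_fun l) = comb_fun (translate g l)"
proof
  fix s
  have "represents (\<lambda>_. translate g l) (lreg g (comb_fun l))"
    using represents_lreg[OF represents_comb_fun[OF assms(1)] assms(2)] .
  then show "lreg g (comb_fun l) s = comb_fun (translate g l) s"
    by (auto simp: represents_def comb_fun_def LIMSEQ_const_iff)
qed

definition lreg_rep :: "'a \<Rightarrow> ('a \<Rightarrow> complex) \<Rightarrow> 'a \<Rightarrow> complex" where
  "lreg_rep g = restrict (lreg g) (carrier rkhs)"

lemma unitary_op_lreg_rep:
  assumes g: "g \<in> carrier G"
  shows "unitary_op rkhs (lreg_rep g)"
  unfolding unitary_op_def bounded_ops_def
proof (intro conjI CollectI ballI allI)
  interpret R: abelian_group rkhs by (rule abelian_group_rkhs)
  interpret M: module "ring_of_type_algebra :: complex ring" rkhs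
    using hilbert_space_rkhs by (simp add: hilbert_space_def)
  show "lreg_rep g \<in> carrier rkhs \<rightarrow>\<^sub>E carrier rkhs"
    using g by (auto simp: lreg_rep_def lreg_closed)
  show "lreg_rep g (F \<oplus>\<^bsub>rkhs\<^esub> F') = lreg_rep g F \<oplus>\<^bsub>rkhs\<^esub> lreg_rep g F'"
    if "F \<in> carrier rkhs" "F' \<in> carrier rkhs" for F F'
  proof -
    have "F \<oplus>\<^bsub>rkhs\<^esub> F' \<in> carrier rkhs"
      using that by simp
    then show ?thesis
      using that by (auto simp: lreg_rep_def rkhs_simps lreg_def)
  qed
  show "lreg_rep g (c \<odot>\<^bsub>rkhs\<^esub> F) = c \<odot>\<^bsub>rkhs\<^esub> lreg_rep g F" if "F \<in> carrier rkhs" for c F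
  proof -
    have "c \<odot>\<^bsub>rkhs\<^esub> F \<in> carrier rkhs"
      using that by (simp add: ring_of_type_algebra_def M.smult_closed)
    then show ?thesis
      using that by (auto simp: lreg_rep_def rkhs_simps lreg_def)
  qed
  show "\<exists>B. \<forall>F\<in>carrier rkhs. hnorm rkhs (lreg_rep g F) \<le> B * hnorm rkhs F"
    using g by (intro exI[of _ 1]) (simp add: lreg_rep_def hnorm_lreg)
  show "lreg_rep g ` carrier rkhs = carrier rkhs"
  proof (intro equalityI subsetI)
    fix F assume F: "F \<in> carrier rkhs"
    then have "F = lreg_rep g (lreg (inv g) F)"
      using g by (simp add: lreg_rep_def lreg_closed lreg_mult lreg_one)
    then show "F \<in> lreg_rep g ` carrier rkhs"
      using F g by (metis imageI inv_closed lreg_closed)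
  qed (use g in \<open>auto simp: lreg_rep_def lreg_closed\<close>)
  show "cinner rkhs (lreg_rep g F) (lreg_rep g F') = cinner rkhs F F'"
    if "F \<in> carrier rkhs" "F' \<in> carrier rkhs" for F F'
    using that g by (simp add: lreg_rep_def cinner_lreg)
qed

lemma unitary_rep_lreg_rep: "unitary_rep G rkhs lreg_rep"
proof -
  have "lreg_rep g \<in> carrier (unitary_group rkhs (bounded_ops rkhs))" if "g \<in> carrier G" for g
    using unitary_op_lreg_rep[OF that] by (simp add: unitary_group_def unitary_op_def)
  moreover have "lreg_rep (g \<otimes> h) = compose (carrier rkhs) (lreg_rep g) (lreg_rep h)"
    if "g \<in> carrier G" "h \<in> carrier G" for g h
    using that by (auto simp: fun_eq_iff compose_def lreg_rep_def lreg_closed lreg_mult)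
  ultimately show ?thesis
    by (simp add: unitary_rep_def hilbert_space_rkhs hom_def unitary_group_def)
qed

text \<open>The GNS vector: its matrix coefficient under \<open>lreg\<close> is
  \<open>\<phi>\<close>. As a function it takes the value \<open>\<phi> (inv s)\<close> at
  \<open>s\<close> in the carrier.\<close>

definition cyclic_vector :: "'a \<Rightarrow> complex" where
  "cyclic_vector = comb_fun [(1, \<one>)]"

lemma cyclic_vector_closed: "cyclic_vector \<in> carrier rkhs"
  unfolding cyclic_vector_def by (intro rkhs_carrierI[OF represents_comb_fun]) simp

lemma hnorm_cyclic_vector: "(hnorm rkhs cyclic_vector)\<^sup>2 = Re (\<phi> \<one>)"
  using qform_tendsto_hnorm[OF represents_comb_fun[of "[(1, \<one>)]"]]
  by (simp add: cyclic_vector_def qform_def kernel_form_def LIMSEQ_const_iff)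

text \<open>Hermitian symmetry at the points \<open>s\<close> and \<open>\<one>\<close> says that
  \<open>\<phi> (inv s)\<close> is the conjugate of \<open>\<phi> s\<close>.\<close>

lemma Re_inv: "s \<in> carrier G \<Longrightarrow> Re (\<phi> (inv s)) = Re (\<phi> s)"
  using form_hermitian[of "[(1, s)]" "[(1, \<one>)]"] by (simp add: kernel_form_def)

text \<open>Expanding the square translates the displacement of a vector, the language of property
  (T), into the deviation of \<open>\<phi>\<close> from its value at the unit.\<close>

lemma hnorm_lreg_cyclic_vector:
  assumes "s \<in> carrier G"
  shows "(hnorm rkhs (\<lambda>t. lreg s cyclic_vector t - cyclic_vector t))\<^sup>2 = 2 * (Re (\<phi> \<one>) - Re (\<phi> s))"
proof -
  have "lreg s cyclic_vector = comb_fun [(1, s)]"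
    using assms by (simp add: cyclic_vector_def lreg_comb_fun comb_translate_def)
  then have "(hnorm rkhs (\<lambda>t. lreg s cyclic_vector t - cyclic_vector t))\<^sup>2 = qform (comb_diff [(1, s)] [(1, \<one>)])"
    using assms unfolding cyclic_vector_def by (simp add: hnorm_comb_fun_diff)
  also have "\<dots> = 2 * (Re (\<phi> \<one>) - Re (\<phi> s))"
    using assms by (simp add: qform_def) (simp add: kernel_form_def Re_inv)
  finally show ?thesis .
qed

text \<open>This serves the case of displacement 0 on the generators, about which
  \<open>property_T\<close> makes no claim.\<close>

lemma invariant_generate:
  assumes "E \<subseteq> carrier G" "F \<in> carrier rkhs" "\<And>s. s \<in> E \<Longrightarrow> lreg s F = F" "s \<in> generate G E"
  shows "lreg s F = F"
  using assms(4)
proof (induction rule: generate.induct)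
  case one
  then show ?case using assms(2) by (rule lreg_one)
next
  case (incl h)
  then show ?case by (rule assms(3))
next
  case (inv h)
  then have "lreg (inv h) F = lreg (inv h) (lreg h F)"
    by (simp add: assms(3))
  also have "\<dots> = F"
    using inv assms(1,2) by (subst lreg_mult) (auto simp: lreg_one subsetD)
  finally show ?case .
next
  case (eng h1 h2)
  then show ?case
    using generate_in_carrier[OF assms(1)] lreg_mult[of h1 h2 F] by simp
qed

end

text \<open>
  A vector within \<open>r\<close> of an invariant vector is moved by at most \<open>2 r\<close>: property (T) gives uniform
  control over the whole group, not only over the generators.
\<close>

lemma property_T_pos_def_function:
  fixes G :: "('g, 'm) monoid_scheme"
  assumes "group G" "property_T G"
  obtains E where "finite E" "E \<subseteq> carrier G"
    "\<And>\<delta>. \<delta> > 0 \<Longrightarrow> \<exists>\<epsilon>>0. \<forall>\<phi>. pos_def_function G \<phi> \<longrightarrow> \<phi> \<one>\<^bsub>G\<^esub> = 1 \<longrightarrow>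
       (\<forall>s\<in>E. 1 - Re (\<phi> s) \<le> \<epsilon>) \<longrightarrow> (\<forall>s\<in>carrier G. 1 - Re (\<phi> s) < \<delta>)"
proof -
  obtain E f where E: "finite E" "E \<noteq> {}" "E \<subseteq> carrier G" "generate G E = carrier G"
    and lim: "(f \<longlongrightarrow> 0) (at_right (0::real))"
    and f: "\<And>(H :: ('g \<Rightarrow> complex) hilbert) \<pi> \<xi> \<epsilon>.
           unitary_rep G H \<pi> \<Longrightarrow> \<xi> \<in> carrier H \<Longrightarrow> hnorm H \<xi> = 1 \<Longrightarrow>
           \<epsilon> = Max ((\<lambda>s. hnorm H (\<pi> s \<xi> \<ominus>\<^bsub>H\<^esub> \<xi>)) ` E) \<Longrightarrow> 0 < \<epsilon> \<Longrightarrow>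
           (\<exists>\<eta>\<in>carrier H. hnorm H (\<xi> \<ominus>\<^bsub>H\<^esub> \<eta>) < (f \<epsilon> :: real) \<and>
              (\<forall>s\<in>carrier G. \<pi> s \<eta> = \<eta>))"
    using assms(2) unfolding property_T_def by blast
  have "\<exists>\<epsilon>>0. \<forall>\<phi>. pos_def_function G \<phi> \<longrightarrow> \<phi> \<one>\<^bsub>G\<^esub> = 1 \<longrightarrow>
       (\<forall>s\<in>E. 1 - Re (\<phi> s) \<le> \<epsilon>) \<longrightarrow> (\<forall>s\<in>carrier G. 1 - Re (\<phi> s) < \<delta>)" if \<delta>: "\<delta> > 0" for \<delta> :: real
  proof -
    \<comment> \<open>An invariant vector at distance less than \<open>sqrt (\<delta> / 2)\<close>
      yields \<open>2 * (1 - Re (\<phi> s)) < 4 * (\<delta> / 2)\<close>, which is the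
      claim.\<close>
    have "\<forall>\<^sub>F x in at_right 0. f x < sqrt (\<delta> / 2)"
      using lim by (rule order_tendstoD) (use \<delta> in simp)
    then obtain r where r: "r > 0" "\<And>x. 0 < x \<Longrightarrow> x < r \<Longrightarrow> f x < sqrt (\<delta> / 2)"
      unfolding eventually_at_right_field by blast
    \<comment> \<open>The squared displacement is \<open>2 * (1 - Re (\<phi> s))\<close>, so this
      witness keeps the displacement on \<open>E\<close> at most \<open>r / 2\<close>, strictly
      below \<open>r\<close>.\<close>
    show ?thesis
    proof (intro exI[of _ "(r / 2)\<^sup>2 / 2"] conjI allI impI ballI)
      show "(r / 2)\<^sup>2 / 2 > 0"
        using r by simp
      fix \<phi> s
      assume "pos_def_function G \<phi>" and one: "\<phi> \<one>\<^bsub>G\<^esub> = 1"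
        and small: "\<forall>s\<in>E. 1 - Re (\<phi> s) \<le> (r / 2)\<^sup>2 / 2" and s: "s \<in> carrier G"
      then interpret pos_def_function G \<phi> by simp
      let ?\<xi> = cyclic_vector
      have lreg_rep: "lreg_rep t ?\<xi> \<ominus>\<^bsub>rkhs\<^esub> ?\<xi> = (\<lambda>x. lreg t ?\<xi> x - ?\<xi> x)" if "t \<in> carrier G" for t
        using that by (simp add: lreg_rep_def cyclic_vector_closed lreg_closed rkhs_minus)
      have sqr: "(hnorm rkhs (\<lambda>x. lreg t ?\<xi> x - ?\<xi> x))\<^sup>2 = 2 * (1 - Re (\<phi> t))" if "t \<in> carrier G" for t
        using hnorm_lreg_cyclic_vector[OF that] one by simp
      have nonneg: "0 \<le> hnorm rkhs F" if "F \<in> carrier rkhs" for F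
        using that by (simp add: hnorm_def Re_cinner_rkhs_nonneg)
      define \<epsilon> where "\<epsilon> = Max ((\<lambda>s. hnorm rkhs (lreg_rep s ?\<xi> \<ominus>\<^bsub>rkhs\<^esub> ?\<xi>)) ` E)"
      have ge: "hnorm rkhs (\<lambda>x. lreg t ?\<xi> x - ?\<xi> x) \<le> \<epsilon>" if "t \<in> E" for t
        using E that lreg_rep[of t] unfolding \<epsilon>_def by (intro Max_ge) (auto intro!: image_eqI[of _ _ t])
      obtain t where t: "t \<in> E" "\<epsilon> = hnorm rkhs (lreg_rep t ?\<xi> \<ominus>\<^bsub>rkhs\<^esub> ?\<xi>)"
        using Max_in[of "(\<lambda>s. hnorm rkhs (lreg_rep s ?\<xi> \<ominus>\<^bsub>rkhs\<^esub> ?\<xi>)) ` E"] E unfolding \<epsilon>_def by blast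
      then have \<epsilon>t: "\<epsilon> = hnorm rkhs (\<lambda>x. lreg t ?\<xi> x - ?\<xi> x)" and "t \<in> carrier G"
        using E lreg_rep by auto
      have "\<epsilon>\<^sup>2 \<le> (r / 2)\<^sup>2"
        using sqr[OF \<open>t \<in> carrier G\<close>] small t(1) \<epsilon>t by auto
      then have "\<epsilon> \<le> r / 2"
        by (rule power2_le_imp_le) (use r in simp)
      obtain \<eta> where \<eta>: "\<eta> \<in> carrier rkhs" "(hnorm rkhs (\<lambda>x. ?\<xi> x - \<eta> x))\<^sup>2 < \<delta> / 2" "lreg s \<eta> = \<eta>"
      proof (cases "\<epsilon> > 0")
        case True
        have norm: "hnorm rkhs ?\<xi> = 1"
          using hnorm_cyclic_vector one nonneg[OF cyclic_vector_closed]
          by (simp add: power2_eq_1_iff)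
        obtain \<eta> where \<eta>: "\<eta> \<in> carrier rkhs" "hnorm rkhs (?\<xi> \<ominus>\<^bsub>rkhs\<^esub> \<eta>) < f \<epsilon>" "\<forall>s\<in>carrier G. lreg_rep s \<eta> = \<eta>"
          using f[OF unitary_rep_lreg_rep cyclic_vector_closed norm \<epsilon>_def True] by blast
        have "hnorm rkhs (\<lambda>x. ?\<xi> x - \<eta> x) < sqrt (\<delta> / 2)"
          using \<eta>(1,2) r(2)[OF True] \<open>\<epsilon> \<le> r / 2\<close> r(1) by (simp add: rkhs_minus cyclic_vector_closed)
        then have "(hnorm rkhs (\<lambda>x. ?\<xi> x - \<eta> x))\<^sup>2 < (sqrt (\<delta> / 2))\<^sup>2"
          using \<eta>(1) by (intro power_strict_mono nonneg rkhs_diff_closed cyclic_vector_closed) auto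
        then show thesis
          using \<eta>(1,3) s \<delta> by (intro that[of \<eta>]) (auto simp: lreg_rep_def)
      next
        \<comment> \<open>Every generator fixes the cyclic vector, which therefore serves as
          \<open>\<eta>\<close> itself.\<close>
        case False
        have "lreg t ?\<xi> = ?\<xi>" if "t \<in> E" for t
        proof -
          have tG: "t \<in> carrier G"
            using that E by auto
          then have c: "(\<lambda>x. lreg t ?\<xi> x - ?\<xi> x) \<in> carrier rkhs"
            by (intro rkhs_diff_closed lreg_closed cyclic_vector_closed)
          have "hnorm rkhs (\<lambda>x. lreg t ?\<xi> x - ?\<xi> x) \<le> 0"
            using ge[OF that] False by linarith
          then have "(\<lambda>x. lreg t ?\<xi> x - ?\<xi> x) = (\<lambda>_. 0)"
            using rkhs_pos[OF c] by (auto simp: hnorm_def)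
          then show ?thesis
            by (simp add: fun_eq_iff)
        qed
        then have "lreg s ?\<xi> = ?\<xi>"
          using invariant_generate[OF E(3) cyclic_vector_closed] E(4) s by blast
        moreover have "(hnorm rkhs (\<lambda>x. ?\<xi> x - ?\<xi> x))\<^sup>2 = 0"
          using hnorm_comb_fun_diff[of "[(1, \<one>\<^bsub>G\<^esub>)]" "[(1, \<one>\<^bsub>G\<^esub>)]"] by (simp add: cyclic_vector_def)
        ultimately show thesis
          using \<delta> by (intro that[of ?\<xi>]) (auto simp: cyclic_vector_closed)
      qed
      have "hnorm rkhs (\<lambda>x. lreg s ?\<xi> x - \<eta> x) = hnorm rkhs (lreg s (\<lambda>x. ?\<xi> x - \<eta> x))"
        by (simp add: lreg_diff \<eta>(3))
      also have "\<dots> = hnorm rkhs (\<lambda>x. ?\<xi> x - \<eta> x)"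
        using \<eta>(1) s by (simp add: hnorm_lreg rkhs_diff_closed cyclic_vector_closed)
      finally have "2 * (1 - Re (\<phi> s)) \<le> 4 * (hnorm rkhs (\<lambda>x. ?\<xi> x - \<eta> x))\<^sup>2"
        using hnorm_rkhs_diff_triangle[of "lreg s ?\<xi>" \<eta> ?\<xi>] sqr[OF s] \<eta>(1) s
        by (simp add: cyclic_vector_closed lreg_closed hnorm_rkhs_diff_sym[of \<eta> ?\<xi>])
      then show "1 - Re (\<phi> s) < \<delta>"
        using \<eta>(2) by simp
    qed
  qed
  then show thesis
    using that E by blast
qed

section \<open>Simple quotients\<close>

lemma group_hom_rcoset:
  assumes "B \<lhd> G"
  shows "group_hom G (G Mod B) (\<lambda>a. B #>\<^bsub>G\<^esub> a)"
proof -
  interpret normal B G by (rule assms)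
  show ?thesis
    by (simp add: group_hom_def group_hom_axioms_def factorgroup_is_group r_coset_hom_Mod is_group)
qed

lemma kernel_rcoset:
  assumes "B \<lhd> G"
  shows "kernel G (G Mod B) (\<lambda>a. B #>\<^bsub>G\<^esub> a) = B"
proof -
  interpret normal B G by (rule assms)
  show ?thesis
    using coset_join1[of B] coset_join2[of _ B] subset is_subgroup by (auto simp: kernel_def)
qed

text \<open>The image of \<open>A\<close> in the simple group \<open>G Mod B\<close> is normal,
  hence trivial or everything.\<close>

lemma simple_quotient_dichotomy:
  assumes "A \<lhd> G" "B \<lhd> G" "is_simple (G Mod B)"
  shows "A \<subseteq> B \<or> (\<forall>s\<in>carrier G. \<exists>t\<in>A. B #>\<^bsub>G\<^esub> t = B #>\<^bsub>G\<^esub> s)"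
proof -
  interpret B: normal B G by (rule assms(2))
  interpret A: normal A G by (rule assms(1))
  have "(\<lambda>a. B #>\<^bsub>G\<^esub> a) ` A \<lhd> G Mod B"
    using A.surj_hom_normal_subgroup[OF group_hom_rcoset[OF assms(2)]] by (simp add: carrier_FactGroup)
  then have disj: "(\<lambda>a. B #>\<^bsub>G\<^esub> a) ` A = carrier (G Mod B) \<or> (\<lambda>a. B #>\<^bsub>G\<^esub> a) ` A = {B}"
    using assms(3) by (auto simp: is_simple_def)
  show ?thesis
  proof (cases "(\<lambda>a. B #>\<^bsub>G\<^esub> a) ` A = {B}")
    case True
    have "A \<subseteq> B"
    proof
      fix a assume a: "a \<in> A"
      then have "B #>\<^bsub>G\<^esub> a \<in> {B}"
        unfolding True [symmetric] by (rule imageI)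
      then have "a \<in> kernel G (G Mod B) (\<lambda>a. B #>\<^bsub>G\<^esub> a)"
        using A.subset a by (simp add: kernel_def subsetD)
      then show "a \<in> B"
        by (simp only: kernel_rcoset[OF assms(2)])
    qed
    then show ?thesis by (rule disjI1)
  next
    case False
    have "\<forall>s\<in>carrier G. \<exists>t\<in>A. B #>\<^bsub>G\<^esub> t = B #>\<^bsub>G\<^esub> s"
    proof
      fix s assume "s \<in> carrier G"
      then have "B #>\<^bsub>G\<^esub> s \<in> carrier (G Mod B)"
        unfolding carrier_FactGroup by (rule imageI)
      then have "B #>\<^bsub>G\<^esub> s \<in> (\<lambda>a. B #>\<^bsub>G\<^esub> a) ` A"
        using disj False by metis
      then show "\<exists>t\<in>A. B #>\<^bsub>G\<^esub> t = B #>\<^bsub>G\<^esub> s"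
        unfolding image_iff by metis
    qed
    then show ?thesis by (rule disjI2)
  qed
qed

lemma simple_quotient_nontrivial:
  assumes "B \<lhd> G" "is_simple (G Mod B)"
  shows "B \<noteq> carrier G"
proof
  interpret B: normal B G by (rule assms(1))
  assume "B = carrier G"
  then have "carrier (G Mod B) = {B}"
    using B.rcos_const[OF B.is_group] B.one_closed by (auto simp: carrier_FactGroup)
  then show False
    using assms(2) by (simp add: is_simple_def)
qed

text \<open>By the dichotomy only \<open>A \<subseteq> B\<close> has to be excluded. If it held,
  \<open>B\<close> would not lie in \<open>A\<close>, so \<open>B\<close> would meet every coset of
  \<open>A\<close>; as these cosets then lie in \<open>B\<close>, the quotient by \<open>B\<close>
  would be trivial.\<close>

lemma simple_quotients_cover:
  assumes "A \<lhd> G" "B \<lhd> G" "is_simple (G Mod A)" "is_simple (G Mod B)" "A \<noteq> B" "s \<in> carrier G"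
  obtains t where "t \<in> A" "B #>\<^bsub>G\<^esub> t = B #>\<^bsub>G\<^esub> s"
proof -
  interpret A: normal A G by (rule assms(1))
  interpret B: normal B G by (rule assms(2))
  have "\<not> A \<subseteq> B"
  proof
    assume "A \<subseteq> B"
    then have "\<forall>s\<in>carrier G. \<exists>t\<in>B. A #>\<^bsub>G\<^esub> t = A #>\<^bsub>G\<^esub> s"
      using simple_quotient_dichotomy[OF assms(2,1,3)] assms(5) by (metis subset_antisym)
    \<comment> \<open>A coset of \<open>A\<close> that meets \<open>B\<close> lies in
      \<open>B\<close>, because \<open>A \<subseteq> B\<close>.\<close>
    moreover have "s \<in> B" if "t \<in> B" "A #>\<^bsub>G\<^esub> t = A #>\<^bsub>G\<^esub> s" "s \<in> carrier G" for s t
    proof -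
      have "s \<in> A #>\<^bsub>G\<^esub> t"
        using that A.rcos_self[OF that(3) A.is_subgroup] by simp
      then show ?thesis
        using \<open>A \<subseteq> B\<close> that(1) by (auto simp: r_coset_def)
    qed
    ultimately have "carrier G \<subseteq> B"
      by (metis subsetI)
    then show False
      using simple_quotient_nontrivial[OF assms(2,4)] B.subset by blast
  qed
  then show thesis
    using simple_quotient_dichotomy[OF assms(1,2,4)] assms(6) that by metis
qed

section \<open>Countability\<close>

text \<open>The map \<open>x s = \<rho> s \<otimes> inv (\<sigma> s)\<close> need not be a
  homomorphism, but the trace property moves \<open>\<sigma> t\<close> cyclically and turns
  \<open>\<phi> (x (inv t \<otimes> s))\<close> into
  \<open>\<phi> (inv (x t) \<otimes> x s)\<close>. The new kernel is thus the old one pulled back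
  along \<open>x\<close>.\<close>

lemma (in pos_def_function) pos_def_function_twist:
  fixes \<Gamma> :: "('g, 'm) monoid_scheme"
  assumes "group \<Gamma>" "\<rho> \<in> hom \<Gamma> G" "\<sigma> \<in> hom \<Gamma> G"
    and trace: "\<And>x y. x \<in> carrier G \<Longrightarrow> y \<in> carrier G \<Longrightarrow> \<phi> (x \<otimes> y) = \<phi> (y \<otimes> x)"
  shows "pos_def_function \<Gamma> (\<lambda>s. \<phi> (\<rho> s \<otimes> inv (\<sigma> s)))"
proof -
  interpret \<Gamma>: group \<Gamma> by (rule assms(1))
  interpret \<rho>: group_hom \<Gamma> G \<rho>
    using assms by (unfold_locales) auto
  interpret \<sigma>: group_hom \<Gamma> G \<sigma>
    using assms by (unfold_locales) auto
  define x where "x s = \<rho> s \<otimes> inv (\<sigma> s)" for s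
  have x: "x s \<in> carrier G" if "s \<in> carrier \<Gamma>" for s
    using that by (simp add: x_def)
  have K: "\<phi> (x (inv\<^bsub>\<Gamma>\<^esub> t \<otimes>\<^bsub>\<Gamma>\<^esub> s)) = \<phi> (inv (x t) \<otimes> x s)" if "s \<in> carrier \<Gamma>" "t \<in> carrier \<Gamma>" for s t
  proof -
    have "x (inv\<^bsub>\<Gamma>\<^esub> t \<otimes>\<^bsub>\<Gamma>\<^esub> s) = (inv (\<rho> t) \<otimes> (\<rho> s \<otimes> inv (\<sigma> s))) \<otimes> \<sigma> t"
      using that by (simp add: x_def inv_mult_group m_assoc)
    moreover have "inv (x t) \<otimes> x s = \<sigma> t \<otimes> (inv (\<rho> t) \<otimes> (\<rho> s \<otimes> inv (\<sigma> s)))"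
      using that by (simp add: x_def inv_mult_group m_assoc)
    ultimately show ?thesis
      using that by (simp add: trace)
  qed
  have "pos_def_kernel (carrier \<Gamma>) (\<lambda>s t. \<phi> (x (inv\<^bsub>\<Gamma>\<^esub> t \<otimes>\<^bsub>\<Gamma>\<^esub> s)))"
  proof
    fix l :: "(complex \<times> 'g) list"
    assume l: "snd ` set l \<subseteq> carrier \<Gamma>"
    then have l': "snd p \<in> carrier \<Gamma>" if "p \<in> set l" for p
      using that by auto
    have "kernel_form (\<lambda>s t. \<phi> (x (inv\<^bsub>\<Gamma>\<^esub> t \<otimes>\<^bsub>\<Gamma>\<^esub> s))) l l = form (map (\<lambda>(c, s). (c, x s)) l) (map (\<lambda>(c, s). (c, x s)) l)"
      by (simp add: kernel_form_def case_prod_unfold o_def K l' cong: map_cong)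
    also have "\<dots> \<in> \<real>\<^sub>\<ge>\<^sub>0"
      using l' x by (intro form_nonneg) auto
    finally show "kernel_form (\<lambda>s t. \<phi> (x (inv\<^bsub>\<Gamma>\<^esub> t \<otimes>\<^bsub>\<Gamma>\<^esub> s))) l l \<in> \<real>\<^sub>\<ge>\<^sub>0" .
  qed
  then show ?thesis
    by (simp add: pos_def_function_def pos_def_function_axioms_def \<Gamma>.is_group x_def)
qed

text \<open>Here \<open>1 - Re (\<tau> (inv v \<otimes> u))\<close> is half of the squared distance of \<open>u\<close> and \<open>v\<close> in the 2-norm of the trace \<open>\<tau>\<close>.\<close>

lemma countable_simple_quotients_of_tracial_group:
  fixes \<Gamma> :: "('g, 'm) monoid_scheme" and U :: "('u, 'n) monoid_scheme" and d :: "real \<Rightarrow> 'u \<Rightarrow> 'd"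
  assumes "group \<Gamma>" "property_T \<Gamma>"
    and N: "\<And>\<alpha>. \<alpha> \<in> J \<Longrightarrow> N \<alpha> \<lhd> \<Gamma>" "inj_on N J" "\<And>\<alpha>. \<alpha> \<in> J \<Longrightarrow> is_simple (\<Gamma> Mod N \<alpha>)"
    and \<rho>: "\<And>\<alpha>. \<alpha> \<in> J \<Longrightarrow> \<rho> \<alpha> \<in> hom \<Gamma> U" "\<And>\<alpha>. \<alpha> \<in> J \<Longrightarrow> kernel \<Gamma> U (\<rho> \<alpha>) = N \<alpha>"
    and pos_def: "pos_def_function U \<tau>" and one: "\<tau> \<one>\<^bsub>U\<^esub> = 1"
    and trace: "\<And>x y. x \<in> carrier U \<Longrightarrow> y \<in> carrier U \<Longrightarrow> \<tau> (x \<otimes>\<^bsub>U\<^esub> y) = \<tau> (y \<otimes>\<^bsub>U\<^esub> x)"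
    and faithful: "\<And>x. x \<in> carrier U \<Longrightarrow> x \<noteq> \<one>\<^bsub>U\<^esub> \<Longrightarrow> 0 < 1 - Re (\<tau> x)"
    and separable: "\<And>e. e > 0 \<Longrightarrow> countable (d e ` carrier U)"
      "\<And>e u v. e > 0 \<Longrightarrow> u \<in> carrier U \<Longrightarrow> v \<in> carrier U \<Longrightarrow> d e u = d e v \<Longrightarrow> 1 - Re (\<tau> (inv\<^bsub>U\<^esub> v \<otimes>\<^bsub>U\<^esub> u)) \<le> e"
  shows "countable J"
proof (rule ccontr)
  assume unc: "uncountable J"
  interpret U: pos_def_function U \<tau> by (rule pos_def)
  have hom: "group_hom \<Gamma> U (\<rho> \<alpha>)" if "\<alpha> \<in> J" for \<alpha>
    using assms(1) \<rho>(1)[OF that] by (simp add: group_hom_def group_hom_axioms_def U.is_group)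
  \<comment> \<open>The threshold has to be uniform in \<alpha> before property (T) is invoked,
    since the tolerance on the generators depends on it.\<close>
  define J' where "J' n = {\<alpha> \<in> J. \<exists>s\<in>carrier \<Gamma>. inverse (real (Suc n)) < 1 - Re (\<tau> (\<rho> \<alpha> s))}" for n
  have "J \<subseteq> (\<Union>n. J' n)"
  proof
    fix \<alpha> assume \<alpha>: "\<alpha> \<in> J"
    interpret \<rho>: group_hom \<Gamma> U "\<rho> \<alpha>" by (rule hom[OF \<alpha>])
    have "N \<alpha> \<noteq> carrier \<Gamma>"
      using simple_quotient_nontrivial N \<alpha> by blast
    then obtain s where s: "s \<in> carrier \<Gamma>" "\<rho> \<alpha> s \<noteq> \<one>\<^bsub>U\<^esub>"
      using \<rho>(2)[OF \<alpha>] by (auto simp: kernel_def)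
    then show "\<alpha> \<in> (\<Union>n. J' n)"
      using reals_Archimedean[OF faithful[of "\<rho> \<alpha> s"]] \<alpha> by (auto simp: J'_def)
  qed
  then obtain n where n: "uncountable (J' n)"
    using unc by (meson countable_UN countable_subset countableI_type)
  define \<delta> where "\<delta> = inverse (real (Suc n))"
  have "\<delta> > 0"
    by (simp add: \<delta>_def)
  obtain E where E: "finite E" "E \<subseteq> carrier \<Gamma>"
    and rigid: "\<And>\<delta>. \<delta> > 0 \<Longrightarrow> \<exists>\<epsilon>>0. \<forall>\<phi>. pos_def_function \<Gamma> \<phi> \<longrightarrow> \<phi> \<one>\<^bsub>\<Gamma>\<^esub> = 1 \<longrightarrow>
       (\<forall>s\<in>E. 1 - Re (\<phi> s) \<le> \<epsilon>) \<longrightarrow> (\<forall>s\<in>carrier \<Gamma>. 1 - Re (\<phi> s) < \<delta>)"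
    using property_T_pos_def_function[OF assms(1,2)] by blast
  obtain \<epsilon> where \<epsilon>: "\<epsilon> > 0"
    and rigid: "\<And>\<phi> s. pos_def_function \<Gamma> \<phi> \<Longrightarrow> \<phi> \<one>\<^bsub>\<Gamma>\<^esub> = 1 \<Longrightarrow>
       (\<forall>s\<in>E. 1 - Re (\<phi> s) \<le> \<epsilon>) \<Longrightarrow> s \<in> carrier \<Gamma> \<Longrightarrow> 1 - Re (\<phi> s) < \<delta>"
    using rigid[OF \<open>\<delta> > 0\<close>] by blast
  \<comment> \<open>Elements of \<open>U\<close> with equal labels \<open>d \<epsilon>\<close> are
    close. \<open>D \<alpha>\<close> lists the labels on the finitely many generators, so it has
    only countably many possible values.\<close>
  define D where "D \<alpha> = restrict (\<lambda>s. d \<epsilon> (\<rho> \<alpha> s)) E" for \<alpha>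
  have closed: "\<rho> \<alpha> s \<in> carrier U" if "\<alpha> \<in> J" "s \<in> carrier \<Gamma>" for \<alpha> s
    using \<rho>(1)[OF that(1)] that(2) by (rule hom_in_carrier)
  have "D ` J' n \<subseteq> (\<Pi>\<^sub>E s\<in>E. d \<epsilon> ` carrier U)"
    using E(2) closed by (fastforce simp: D_def J'_def)
  moreover have "countable (\<Pi>\<^sub>E s\<in>E. d \<epsilon> ` carrier U)"
    using separable(1)[OF \<epsilon>] by (simp add: countable_PiE E(1))
  ultimately have "\<not> inj_on D (J' n)"
    using n countable_subset[THEN countable_image_inj_on] by metis
  then obtain \<alpha> \<beta> where \<alpha>\<beta>: "\<alpha> \<in> J' n" "\<beta> \<in> J' n" "\<alpha> \<noteq> \<beta>" "D \<alpha> = D \<beta>"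
    by (auto simp: inj_on_def)
  then have J: "\<alpha> \<in> J" "\<beta> \<in> J"
    by (simp_all add: J'_def)
  interpret \<alpha>: group_hom \<Gamma> U "\<rho> \<alpha>" by (rule hom[OF J(1)])
  interpret \<beta>: group_hom \<Gamma> U "\<rho> \<beta>" by (rule hom[OF J(2)])
  \<comment> \<open>This measures how far apart the two homomorphisms are: \<phi> is 1 wherever they
    agree.\<close>
  define \<phi> where "\<phi> s = \<tau> (\<rho> \<alpha> s \<otimes>\<^bsub>U\<^esub> inv\<^bsub>U\<^esub> (\<rho> \<beta> s))" for s
  have "pos_def_function \<Gamma> \<phi>"
    unfolding \<phi>_def using assms(1) \<rho>(1)[OF J(1)] \<rho>(1)[OF J(2)] trace by (rule U.pos_def_function_twist)
  moreover have "\<phi> \<one>\<^bsub>\<Gamma>\<^esub> = 1"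
    by (simp add: \<phi>_def one)
  moreover have "1 - Re (\<phi> s) \<le> \<epsilon>" if "s \<in> E" for s
  proof -
    have s: "s \<in> carrier \<Gamma>"
      using that E(2) by blast
    have "d \<epsilon> (\<rho> \<alpha> s) = d \<epsilon> (\<rho> \<beta> s)"
      using fun_cong[OF \<alpha>\<beta>(4), of s] that by (simp add: D_def)
    then have "1 - Re (\<tau> (inv\<^bsub>U\<^esub> (\<rho> \<beta> s) \<otimes>\<^bsub>U\<^esub> \<rho> \<alpha> s)) \<le> \<epsilon>"
      using separable(2)[OF \<epsilon>] s by simp
    then show ?thesis
      using s by (simp add: \<phi>_def trace)
  qed
  ultimately have close: "1 - Re (\<phi> s) < \<delta>" if "s \<in> carrier \<Gamma>" for s
    using rigid that by blast
  \<comment> \<open>Modulo \<open>N \<beta>\<close> every \<open>s\<close> equals some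
    \<open>t\<close> in \<open>N \<alpha>\<close>. There \<open>\<rho> \<alpha> t\<close> is the
    unit, so \<open>\<phi> t\<close> is the trace of the inverse of \<open>\<rho> \<beta> t\<close>,
    and inversion preserves the real part.\<close>
  have moved: "1 - Re (\<tau> (\<rho> \<beta> s)) < \<delta>" if s: "s \<in> carrier \<Gamma>" for s
  proof -
    have "N \<alpha> \<noteq> N \<beta>"
      using N(2) J \<alpha>\<beta>(3) by (auto simp: inj_on_def)
    then obtain t where t: "t \<in> N \<alpha>" "N \<beta> #>\<^bsub>\<Gamma>\<^esub> t = N \<beta> #>\<^bsub>\<Gamma>\<^esub> s"
      using simple_quotients_cover[OF N(1)[OF J(1)] N(1)[OF J(2)] N(3)[OF J(1)] N(3)[OF J(2)]] s by blast
    have tG: "t \<in> carrier \<Gamma>" and "\<rho> \<alpha> t = \<one>\<^bsub>U\<^esub>"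
      using t(1) \<rho>(2)[OF J(1)] by (auto simp: kernel_def)
    have "s \<in> N \<beta> #>\<^bsub>\<Gamma>\<^esub> t"
      using \<alpha>.G.rcos_self[OF s normal_imp_subgroup[OF N(1)[OF J(2)]]] t(2) by simp
    then obtain r where "r \<in> N \<beta>" "s = r \<otimes>\<^bsub>\<Gamma>\<^esub> t"
      by (auto simp: r_coset_def)
    moreover from this have "r \<in> carrier \<Gamma>" "\<rho> \<beta> r = \<one>\<^bsub>U\<^esub>"
      unfolding \<rho>(2)[OF J(2), symmetric] kernel_def by auto
    ultimately have "\<rho> \<beta> s = \<rho> \<beta> t"
      using tG by simp
    then show ?thesis
      using close[OF tG] \<open>\<rho> \<alpha> t = \<one>\<^bsub>U\<^esub>\<close> tG by (simp add: \<phi>_def U.Re_inv)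
  qed
  obtain s where "s \<in> carrier \<Gamma>" "\<delta> < 1 - Re (\<tau> (\<rho> \<beta> s))"
    using \<alpha>\<beta>(2) unfolding J'_def \<delta>_def by auto
  then show False
    using moved[of s] by linarith
qed

section \<open>Traces of unitaries in a tracial von Neumann algebra\<close>

lemma ring_of_type_algebra_simps:
  "carrier ring_of_type_algebra = UNIV" "monoid.mult ring_of_type_algebra = (*)" "monoid.one ring_of_type_algebra = 1"
  "ring.zero ring_of_type_algebra = 0" "ring.add ring_of_type_algebra = (+)"
  by (simp_all add: ring_of_type_algebra_def)

section \<open>Inner products and bounded operators\<close>

locale complex_hilbert =
  fixes H :: "'h hilbert"
  assumes hilbert_space: "hilbert_space H"

sublocale complex_hilbert \<subseteq> module "ring_of_type_algebra :: complex ring" H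
  using hilbert_space unfolding hilbert_space_def by blast

context complex_hilbert
begin

lemma smult_closed_complex [simp]: "x \<in> carrier H \<Longrightarrow> c \<odot>\<^bsub>H\<^esub> x \<in> carrier H"
  by (rule smult_closed) (simp_all add: ring_of_type_algebra_simps)

lemma cinner_add_left [simp]:
  "x \<in> carrier H \<Longrightarrow> y \<in> carrier H \<Longrightarrow> z \<in> carrier H \<Longrightarrow> cinner H (x \<oplus>\<^bsub>H\<^esub> y) z = cinner H x z + cinner H y z"
  using hilbert_space unfolding hilbert_space_def by blast

lemma cinner_smult_left [simp]:
  "x \<in> carrier H \<Longrightarrow> y \<in> carrier H \<Longrightarrow> cinner H (c \<odot>\<^bsub>H\<^esub> x) y = c * cinner H x y"
  using hilbert_space unfolding hilbert_space_def by blast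

lemma cinner_commute: "x \<in> carrier H \<Longrightarrow> y \<in> carrier H \<Longrightarrow> cinner H y x = cnj (cinner H x y)"
  using hilbert_space unfolding hilbert_space_def by blast

lemma cinner_pos: "x \<in> carrier H \<Longrightarrow> x \<noteq> \<zero>\<^bsub>H\<^esub> \<Longrightarrow> 0 < Re (cinner H x x)"
  using hilbert_space unfolding hilbert_space_def by blast

lemma cinner_add_right [simp]:
  "x \<in> carrier H \<Longrightarrow> y \<in> carrier H \<Longrightarrow> z \<in> carrier H \<Longrightarrow> cinner H z (x \<oplus>\<^bsub>H\<^esub> y) = cinner H z x + cinner H z y"
  using cinner_commute[of "x \<oplus>\<^bsub>H\<^esub> y" z] cinner_commute[of x z] cinner_commute[of y z] by simp

lemma cinner_smult_right [simp]:
  "x \<in> carrier H \<Longrightarrow> y \<in> carrier H \<Longrightarrow> cinner H y (c \<odot>\<^bsub>H\<^esub> x) = cnj c * cinner H y x"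
  using cinner_commute[of "c \<odot>\<^bsub>H\<^esub> x" y] cinner_commute[of x y] by simp

lemma cinner_zero_left [simp]: "y \<in> carrier H \<Longrightarrow> cinner H \<zero>\<^bsub>H\<^esub> y = 0"
  using cinner_add_left[of "\<zero>\<^bsub>H\<^esub>" "\<zero>\<^bsub>H\<^esub>" y] by simp

lemma cinner_self_nonneg: "x \<in> carrier H \<Longrightarrow> 0 \<le> Re (cinner H x x)"
  using cinner_pos[of x] by (cases "x = \<zero>\<^bsub>H\<^esub>") (auto simp: less_imp_le)

lemma minus_add_self: "x \<in> carrier H \<Longrightarrow> y \<in> carrier H \<Longrightarrow> (x \<ominus>\<^bsub>H\<^esub> y) \<oplus>\<^bsub>H\<^esub> y = x"
  by (simp add: a_minus_def M.a_assoc M.l_neg)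

lemma cinner_minus_left:
  assumes "x \<in> carrier H" "y \<in> carrier H" "z \<in> carrier H"
  shows "cinner H (x \<ominus>\<^bsub>H\<^esub> y) z = cinner H x z - cinner H y z"
  using cinner_add_left[of "x \<ominus>\<^bsub>H\<^esub> y" y z] minus_add_self[of x y] assms by simp

lemma cinner_eqI:
  assumes "x \<in> carrier H" "y \<in> carrier H" "\<And>z. z \<in> carrier H \<Longrightarrow> cinner H x z = cinner H y z"
  shows "x = y"
proof (rule ccontr)
  assume "x \<noteq> y"
  then have "x \<ominus>\<^bsub>H\<^esub> y \<noteq> \<zero>\<^bsub>H\<^esub>"
    using minus_add_self[of x y] assms by auto
  then have "0 < Re (cinner H (x \<ominus>\<^bsub>H\<^esub> y) (x \<ominus>\<^bsub>H\<^esub> y))"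
    using assms by (intro cinner_pos) simp_all
  then show False
    using assms by (simp add: cinner_minus_left)
qed

lemma hnorm_nonneg: "x \<in> carrier H \<Longrightarrow> 0 \<le> hnorm H x"
  by (simp add: hnorm_def cinner_self_nonneg)

lemma hnorm_sqr: "x \<in> carrier H \<Longrightarrow> (hnorm H x)\<^sup>2 = Re (cinner H x x)"
  by (simp add: hnorm_def cinner_self_nonneg)

lemma hnorm_smult: "x \<in> carrier H \<Longrightarrow> hnorm H (c \<odot>\<^bsub>H\<^esub> x) = cmod c * hnorm H x"
proof -
  assume x: "x \<in> carrier H"
  have "cinner H (c \<odot>\<^bsub>H\<^esub> x) (c \<odot>\<^bsub>H\<^esub> x) = (c * cnj c) * cinner H x x"
    using x by (simp add: mult_ac)
  also have "\<dots> = of_real ((cmod c)\<^sup>2) * cinner H x x"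
    by (simp only: complex_norm_square)
  finally show ?thesis
    by (simp add: hnorm_def real_sqrt_mult)
qed

text \<open>Expand \<open>\<parallel>x - y\<parallel>\<^sup>2 \<ge> 0\<close>. This replaces the
  triangle inequality where only boundedness matters.\<close>

lemma hnorm_add_sqr:
  assumes "x \<in> carrier H" "y \<in> carrier H"
  shows "(hnorm H (x \<oplus>\<^bsub>H\<^esub> y))\<^sup>2 \<le> 2 * (hnorm H x)\<^sup>2 + 2 * (hnorm H y)\<^sup>2"
proof -
  have "0 \<le> Re (cinner H (x \<oplus>\<^bsub>H\<^esub> (-1) \<odot>\<^bsub>H\<^esub> y) (x \<oplus>\<^bsub>H\<^esub> (-1) \<odot>\<^bsub>H\<^esub> y))"
    using assms by (intro cinner_self_nonneg) simp
  then show ?thesis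
    using assms by (simp add: hnorm_sqr)
qed

lemma bounded_ops_closed: "T \<in> bounded_ops H \<Longrightarrow> x \<in> carrier H \<Longrightarrow> T x \<in> carrier H"
  by (auto simp: bounded_ops_def)

lemma bounded_ops_add:
  "T \<in> bounded_ops H \<Longrightarrow> x \<in> carrier H \<Longrightarrow> y \<in> carrier H \<Longrightarrow> T (x \<oplus>\<^bsub>H\<^esub> y) = T x \<oplus>\<^bsub>H\<^esub> T y"
  by (auto simp: bounded_ops_def)

lemma bounded_ops_smult:
  "T \<in> bounded_ops H \<Longrightarrow> x \<in> carrier H \<Longrightarrow> T (c \<odot>\<^bsub>H\<^esub> x) = c \<odot>\<^bsub>H\<^esub> T x"
  by (auto simp: bounded_ops_def)

lemma bounded_ops_zero: "T \<in> bounded_ops H \<Longrightarrow> T \<zero>\<^bsub>H\<^esub> = \<zero>\<^bsub>H\<^esub>"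
  using bounded_ops_smult[of T "\<zero>\<^bsub>H\<^esub>" 0] smult_l_null[of "\<zero>\<^bsub>H\<^esub>"] smult_l_null[of "T \<zero>\<^bsub>H\<^esub>"]
  by (simp add: ring_of_type_algebra_simps bounded_ops_closed)

lemma bounded_ops_extensional: "T \<in> bounded_ops H \<Longrightarrow> T \<in> extensional (carrier H)"
  by (simp add: bounded_ops_def PiE_iff)

lemma bounded_ops_bound:
  assumes "T \<in> bounded_ops H"
  obtains B where "B \<ge> 0" "\<forall>x\<in>carrier H. hnorm H (T x) \<le> B * hnorm H x"
proof -
  obtain B where B: "\<forall>x\<in>carrier H. hnorm H (T x) \<le> B * hnorm H x"
    using assms unfolding bounded_ops_def by blast
  have "hnorm H (T x) \<le> \<bar>B\<bar> * hnorm H x" if "x \<in> carrier H" for x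
    using B that mult_right_mono[OF abs_ge_self[of B] hnorm_nonneg[OF that]] by fastforce
  then show thesis
    by (intro that[of "\<bar>B\<bar>"]) auto
qed

lemma bounded_opsI:
  assumes "T \<in> extensional (carrier H)" "\<And>x. x \<in> carrier H \<Longrightarrow> T x \<in> carrier H"
    and "\<And>x y. x \<in> carrier H \<Longrightarrow> y \<in> carrier H \<Longrightarrow> T (x \<oplus>\<^bsub>H\<^esub> y) = T x \<oplus>\<^bsub>H\<^esub> T y"
    and "\<And>c x. x \<in> carrier H \<Longrightarrow> T (c \<odot>\<^bsub>H\<^esub> x) = c \<odot>\<^bsub>H\<^esub> T x"
    and "\<And>x. x \<in> carrier H \<Longrightarrow> hnorm H (T x) \<le> B * hnorm H x"
  shows "T \<in> bounded_ops H"
  using assms unfolding bounded_ops_def PiE_def by (auto intro!: exI[of _ B])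

lemma compose_bounded_ops:
  assumes "S \<in> bounded_ops H" "T \<in> bounded_ops H"
  shows "compose (carrier H) S T \<in> bounded_ops H"
proof -
  obtain B where B: "B \<ge> 0" "\<forall>x\<in>carrier H. hnorm H (S x) \<le> B * hnorm H x"
    using bounded_ops_bound[OF assms(1)] .
  obtain D where D: "D \<ge> 0" "\<forall>x\<in>carrier H. hnorm H (T x) \<le> D * hnorm H x"
    using bounded_ops_bound[OF assms(2)] .
  show ?thesis
  proof (rule bounded_opsI[where B = "B * D"])
    fix x assume x: "x \<in> carrier H"
    have "hnorm H (S (T x)) \<le> B * hnorm H (T x)"
      using B(2) bounded_ops_closed[OF assms(2) x] by blast
    also have "\<dots> \<le> B * (D * hnorm H x)"
      using B(1) D(2) x by (simp add: mult_left_mono)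
    finally show "hnorm H (compose (carrier H) S T x) \<le> B * D * hnorm H x"
      using x by (simp add: compose_def)
  qed (use assms in \<open>simp_all add: compose_def bounded_ops_closed bounded_ops_add bounded_ops_smult\<close>)
qed

text \<open>\<open>adj_op\<close> is a definite description, so an explicit adjoint identifies it
  once uniqueness is known; that comes from nondegeneracy. The adjoints computed below, of
  combinations of unitaries, are all explicit.\<close>

lemma adj_op_eqI:
  assumes "S \<in> bounded_ops H" "T \<in> bounded_ops H"
    and "\<And>x y. x \<in> carrier H \<Longrightarrow> y \<in> carrier H \<Longrightarrow> cinner H (T x) y = cinner H x (S y)"
  shows "adj_op H T = S"
  unfolding adj_op_def
proof (rule the_equality)
  fix S' assume S': "S' \<in> bounded_ops H \<and> (\<forall>x\<in>carrier H. \<forall>y\<in>carrier H. cinner H (T x) y = cinner H x (S' y))"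
  show "S' = S"
  proof (rule extensionalityI)
    fix y assume y: "y \<in> carrier H"
    show "S' y = S y"
    proof (rule cinner_eqI)
      fix z assume z: "z \<in> carrier H"
      have "cinner H z (S' y) = cinner H z (S y)"
        using S' assms(3)[OF z y] y z by simp
      then show "cinner H (S' y) z = cinner H (S y) z"
        using S' assms(1) y z cinner_commute bounded_ops_closed by metis
    qed (use S' assms(1) y in \<open>auto intro: bounded_ops_closed\<close>)
  qed (use S' assms(1) in \<open>auto intro: bounded_ops_extensional\<close>)
qed (use assms in auto)

section \<open>Unitaries and their inverses\<close>

text \<open>It is at once the adjoint (\<open>adj_op_unitary\<close>) and the inverse in the unitary
  group (\<open>inv_U\<close>).\<close>

definition uinv :: "('h \<Rightarrow> 'h) \<Rightarrow> 'h \<Rightarrow> 'h" where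
  "uinv u = restrict (inv_into (carrier H) u) (carrier H)"

context
  fixes u assumes u: "unitary_op H u"
begin

lemma unitary_bounded: "u \<in> bounded_ops H"
  using u by (simp add: unitary_op_def)

lemma unitary_closed [simp]: "x \<in> carrier H \<Longrightarrow> u x \<in> carrier H"
  by (rule bounded_ops_closed[OF unitary_bounded])

lemma unitary_cinner [simp]:
  "x \<in> carrier H \<Longrightarrow> y \<in> carrier H \<Longrightarrow> cinner H (u x) (u y) = cinner H x y"
  using u by (simp add: unitary_op_def)

lemma unitary_hnorm [simp]: "x \<in> carrier H \<Longrightarrow> hnorm H (u x) = hnorm H x"
  by (simp add: hnorm_def)

lemma unitary_inj: "inj_on u (carrier H)"
proof (rule inj_onI)
  fix x y assume xy: "x \<in> carrier H" "y \<in> carrier H" "u x = u y"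
  show "x = y"
    using xy unitary_cinner[of x] unitary_cinner[of y] by (intro cinner_eqI) auto
qed

lemma uinv_closed [simp]: "x \<in> carrier H \<Longrightarrow> uinv u x \<in> carrier H"
  using u by (simp add: uinv_def unitary_op_def inv_into_into)

lemma uinv_right [simp]: "x \<in> carrier H \<Longrightarrow> u (uinv u x) = x"
  using u by (simp add: uinv_def unitary_op_def f_inv_into_f)

lemma uinv_left [simp]: "x \<in> carrier H \<Longrightarrow> uinv u (u x) = x"
  by (simp add: uinv_def unitary_inj inv_into_f_f)

lemma cinner_uinv: "x \<in> carrier H \<Longrightarrow> y \<in> carrier H \<Longrightarrow> cinner H (u x) y = cinner H x (uinv u y)"
  using unitary_cinner[of x "uinv u y"] by simp

lemma cinner_uinv': "x \<in> carrier H \<Longrightarrow> y \<in> carrier H \<Longrightarrow> cinner H (uinv u x) y = cinner H x (u y)"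
  using unitary_cinner[of "uinv u x" y] by simp

lemma unitary_uinv: "unitary_op H (uinv u)"
  unfolding unitary_op_def
proof (intro conjI ballI)
  show "uinv u \<in> bounded_ops H"
  proof (rule bounded_opsI[where B = 1])
    show "uinv u \<in> extensional (carrier H)"
      by (simp add: uinv_def)
    show "uinv u (x \<oplus>\<^bsub>H\<^esub> y) = uinv u x \<oplus>\<^bsub>H\<^esub> uinv u y" if "x \<in> carrier H" "y \<in> carrier H" for x y
      \<comment> \<open>Linearity passes to the inverse: \<open>u\<close> is applied to the
        right-hand side and undone by \<open>uinv_left\<close>.\<close>
      using that uinv_left[of "uinv u x \<oplus>\<^bsub>H\<^esub> uinv u y"] by (simp add: bounded_ops_add[OF unitary_bounded])
    show "uinv u (c \<odot>\<^bsub>H\<^esub> x) = c \<odot>\<^bsub>H\<^esub> uinv u x" if "x \<in> carrier H" for c x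
      using that uinv_left[of "c \<odot>\<^bsub>H\<^esub> uinv u x"] by (simp add: bounded_ops_smult[OF unitary_bounded])
    show "hnorm H (uinv u x) \<le> 1 * hnorm H x" if "x \<in> carrier H" for x
      using that unitary_hnorm[of "uinv u x"] by simp
  qed simp
  show "uinv u ` carrier H = carrier H"
    by (force intro: uinv_left[symmetric])
  show "cinner H (uinv u x) (uinv u y) = cinner H x y" if "x \<in> carrier H" "y \<in> carrier H" for x y
    using that by (simp add: cinner_uinv')
qed

lemma adj_op_unitary: "adj_op H u = uinv u"
  using unitary_uinv unitary_bounded by (intro adj_op_eqI) (auto simp: unitary_op_def[of _ "uinv u"] cinner_uinv)

end

section \<open>Linear combinations of operators\<close>

text \<open>The lists are those of \<open>kernel_form\<close>: one list of unitaries determines both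
  a value of the form and an operator, and \<open>kernel_form_trace\<close> relates the two.\<close>

primrec op_eval :: "(complex \<times> ('h \<Rightarrow> 'h)) list \<Rightarrow> 'h \<Rightarrow> 'h" where
  "op_eval [] x = \<zero>\<^bsub>H\<^esub>"
| "op_eval (p # l) x = fst p \<odot>\<^bsub>H\<^esub> snd p x \<oplus>\<^bsub>H\<^esub> op_eval l x"

definition op_comb :: "(complex \<times> ('h \<Rightarrow> 'h)) list \<Rightarrow> 'h \<Rightarrow> 'h" where
  "op_comb l = restrict (op_eval l) (carrier H)"

lemma op_eval_closed [simp]:
  "snd ` set l \<subseteq> bounded_ops H \<Longrightarrow> x \<in> carrier H \<Longrightarrow> op_eval l x \<in> carrier H"
  by (induction l) (auto simp: bounded_ops_closed)

lemma op_comb_Cons: "op_comb (p # l) = (\<lambda>x\<in>carrier H. fst p \<odot>\<^bsub>H\<^esub> snd p x \<oplus>\<^bsub>H\<^esub> op_comb l x)"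
  by (auto simp: op_comb_def)

lemma smult_add_bounded_ops:
  assumes S: "S \<in> bounded_ops H" and T: "T \<in> bounded_ops H"
  shows "(\<lambda>x\<in>carrier H. c \<odot>\<^bsub>H\<^esub> S x \<oplus>\<^bsub>H\<^esub> T x) \<in> bounded_ops H"
proof -
  obtain B where B: "B \<ge> 0" "\<forall>x\<in>carrier H. hnorm H (S x) \<le> B * hnorm H x"
    using bounded_ops_bound[OF S] .
  obtain D where D: "D \<ge> 0" "\<forall>x\<in>carrier H. hnorm H (T x) \<le> D * hnorm H x"
    using bounded_ops_bound[OF T] .
  show ?thesis
  \<comment> \<open>Both summands have norm at most \<open>?n\<close>, so
    \<open>hnorm_add_sqr\<close> bounds the square of the sum by that of \<open>2 * ?n\<close>;
    hence the factor 2.\<close>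
  proof (rule bounded_opsI[where B = "2 * (cmod c * B + D)"])
    fix x assume x: "x \<in> carrier H"
    have Sx: "S x \<in> carrier H" and Tx: "T x \<in> carrier H"
      using S T x by (auto intro: bounded_ops_closed)
    have cS: "hnorm H (c \<odot>\<^bsub>H\<^esub> S x) \<le> cmod c * B * hnorm H x"
      using mult_left_mono[OF bspec[OF B(2) x], of "cmod c"] by (simp add: hnorm_smult Sx mult.assoc)
    let ?n = "(cmod c * B + D) * hnorm H x"
    have "0 \<le> cmod c * B * hnorm H x" "0 \<le> D * hnorm H x"
      using B D hnorm_nonneg[OF x] by simp_all
    then have "hnorm H (c \<odot>\<^bsub>H\<^esub> S x) \<le> ?n" "hnorm H (T x) \<le> ?n"
      using cS bspec[OF D(2) x] by (simp_all add: distrib_right)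
    then have "(hnorm H (c \<odot>\<^bsub>H\<^esub> S x))\<^sup>2 \<le> ?n\<^sup>2" "(hnorm H (T x))\<^sup>2 \<le> ?n\<^sup>2"
      using Sx Tx by (auto intro!: power_mono hnorm_nonneg)
    then have "(hnorm H (c \<odot>\<^bsub>H\<^esub> S x \<oplus>\<^bsub>H\<^esub> T x))\<^sup>2 \<le> (2 * ?n)\<^sup>2"
      using hnorm_add_sqr[of "c \<odot>\<^bsub>H\<^esub> S x" "T x"] Sx Tx unfolding power_mult_distrib by simp
    then have "hnorm H (c \<odot>\<^bsub>H\<^esub> S x \<oplus>\<^bsub>H\<^esub> T x) \<le> 2 * ?n"
      by (rule power2_le_imp_le) (use B D hnorm_nonneg[OF x] in simp)
    then show "hnorm H ((\<lambda>x\<in>carrier H. c \<odot>\<^bsub>H\<^esub> S x \<oplus>\<^bsub>H\<^esub> T x) x) \<le> 2 * (cmod c * B + D) * hnorm H x"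
      using x by (simp only: restrict_apply' mult.assoc)
  next
    show "(\<lambda>x\<in>carrier H. c \<odot>\<^bsub>H\<^esub> S x \<oplus>\<^bsub>H\<^esub> T x) (x \<oplus>\<^bsub>H\<^esub> y)
        = (\<lambda>x\<in>carrier H. c \<odot>\<^bsub>H\<^esub> S x \<oplus>\<^bsub>H\<^esub> T x) x \<oplus>\<^bsub>H\<^esub> (\<lambda>x\<in>carrier H. c \<odot>\<^bsub>H\<^esub> S x \<oplus>\<^bsub>H\<^esub> T x) y"
      if "x \<in> carrier H" "y \<in> carrier H" for x y
      using that S T smult_r_distr[of c "S x" "S y"]
      by (simp add: bounded_ops_add bounded_ops_closed M.a_ac ring_of_type_algebra_simps)
    show "(\<lambda>x\<in>carrier H. c \<odot>\<^bsub>H\<^esub> S x \<oplus>\<^bsub>H\<^esub> T x) (d \<odot>\<^bsub>H\<^esub> x)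
        = d \<odot>\<^bsub>H\<^esub> (\<lambda>x\<in>carrier H. c \<odot>\<^bsub>H\<^esub> S x \<oplus>\<^bsub>H\<^esub> T x) x"
      if "x \<in> carrier H" for d x
      using that S T smult_r_distr[of d "c \<odot>\<^bsub>H\<^esub> S x" "T x"] smult_assoc1[of c d "S x"] smult_assoc1[of d c "S x"]
      by (simp add: bounded_ops_smult bounded_ops_closed ring_of_type_algebra_simps mult.commute)
  qed (use S T in \<open>auto simp: bounded_ops_closed\<close>)
qed

lemma zero_bounded_ops: "(\<lambda>x\<in>carrier H. \<zero>\<^bsub>H\<^esub>) \<in> bounded_ops H"
proof (rule bounded_opsI[where B = 0])
  show "(\<lambda>x\<in>carrier H. \<zero>\<^bsub>H\<^esub>) (c \<odot>\<^bsub>H\<^esub> x) = c \<odot>\<^bsub>H\<^esub> (\<lambda>x\<in>carrier H. \<zero>\<^bsub>H\<^esub>) x" if "x \<in> carrier H" for c x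
    using that smult_r_null[of c] by (simp add: ring_of_type_algebra_simps)
qed (simp_all add: hnorm_def)

lemma op_comb_bounded: "snd ` set l \<subseteq> bounded_ops H \<Longrightarrow> op_comb l \<in> bounded_ops H"
proof (induction l)
  case Nil
  have "op_comb [] = (\<lambda>x\<in>carrier H. \<zero>\<^bsub>H\<^esub>)"
    by (rule ext) (simp add: op_comb_def)
  then show ?case
    using zero_bounded_ops by (simp only:)
next
  case (Cons p l)
  then show ?case
    unfolding op_comb_Cons by (intro smult_add_bounded_ops) auto
qed

lemma bounded_ops_op_eval:
  assumes "T \<in> bounded_ops H" "snd ` set l \<subseteq> bounded_ops H" "x \<in> carrier H"
  shows "T (op_eval l x) = op_eval (map (\<lambda>(c, S). (c, compose (carrier H) T S)) l) x"
  using assms(2)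
proof (induction l)
  case Nil
  then show ?case by (simp add: bounded_ops_zero[OF assms(1)])
next
  case (Cons p l)
  then show ?case
    using assms(1,3)
    by (auto simp: bounded_ops_add bounded_ops_smult bounded_ops_closed compose_def split: prod.split)
qed

lemma unitary_combs_bounded:
  assumes "\<forall>p\<in>set l. unitary_op H (snd p)"
  shows "snd ` set l \<subseteq> bounded_ops H" "snd ` set (map (\<lambda>p. (cnj (fst p), uinv (snd p))) l) \<subseteq> bounded_ops H"
  using assms unitary_bounded unitary_bounded[OF unitary_uinv] by (simp_all add: image_subset_iff)

lemma cinner_op_eval:
  assumes "\<forall>p\<in>set l. unitary_op H (snd p)" "x \<in> carrier H" "y \<in> carrier H"
  shows "cinner H (op_eval l x) y = cinner H x (op_eval (map (\<lambda>p. (cnj (fst p), uinv (snd p))) l) y)"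
  using assms(1)
proof (induction l)
  case Nil
  then show ?case
    using assms(2,3) cinner_commute[of "\<zero>\<^bsub>H\<^esub>" x] by simp
next
  case (Cons p l)
  obtain c u where p: "p = (c, u)" by (cases p)
  have u: "unitary_op H u" and l: "\<forall>p\<in>set l. unitary_op H (snd p)"
    using Cons.prems by (simp_all add: p)
  show ?case
    using unitary_combs_bounded[OF l] Cons.IH[OF l] u assms(2,3) by (simp add: p cinner_uinv)
qed

lemma adj_op_op_comb:
  assumes "\<forall>p\<in>set l. unitary_op H (snd p)"
  shows "adj_op H (op_comb l) = op_comb (map (\<lambda>p. (cnj (fst p), uinv (snd p))) l)"
proof (rule adj_op_eqI)
  show "op_comb l \<in> bounded_ops H" "op_comb (map (\<lambda>p. (cnj (fst p), uinv (snd p))) l) \<in> bounded_ops H"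
    by (intro op_comb_bounded unitary_combs_bounded[OF assms])+
qed (simp add: op_comb_def cinner_op_eval[OF assms])

lemma id_op_bounded: "id_op H \<in> bounded_ops H"
  by (rule bounded_opsI[where B = 1]) (auto simp: id_op_def)

lemma unitary_id_op: "unitary_op H (id_op H)"
  using id_op_bounded by (auto simp: unitary_op_def id_op_def)

lemma unitary_compose:
  assumes u: "unitary_op H u" and v: "unitary_op H v"
  shows "unitary_op H (compose (carrier H) u v)"
proof -
  have "compose (carrier H) u v ` carrier H = u ` v ` carrier H"
    by (simp add: compose_def image_image)
  then show ?thesis
    using u v by (simp add: unitary_op_def compose_bounded_ops) (simp add: compose_def bounded_ops_closed)
qed

text \<open>Used with \<open>commutant H M\<close> for \<open>S\<close>: by the bicommutant
  condition its commutant is \<open>M\<close>, which gives the algebra structure of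
  \<open>M\<close>.\<close>

lemma commutant_closed:
  assumes "S \<subseteq> bounded_ops H"
  shows "id_op H \<in> commutant H S"
    and "T \<in> commutant H S \<Longrightarrow> T' \<in> commutant H S \<Longrightarrow> compose (carrier H) T T' \<in> commutant H S"
    and "snd ` set l \<subseteq> commutant H S \<Longrightarrow> op_comb l \<in> commutant H S"
proof -
  have ext: "compose (carrier H) T A = compose (carrier H) A T \<longleftrightarrow> (\<forall>x\<in>carrier H. T (A x) = A (T x))" for T A
    by (auto simp: compose_def fun_eq_iff)
  show "id_op H \<in> commutant H S"
    using assms bounded_ops_closed by (simp add: commutant_def id_op_bounded ext) (auto simp: id_op_def)
  show "compose (carrier H) T T' \<in> commutant H S" if "T \<in> commutant H S" "T' \<in> commutant H S"
  proof -
    have "T (T' (A x)) = A (T (T' x))" "A x \<in> carrier H" if "A \<in> S" "x \<in> carrier H" for A x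
      using that \<open>T \<in> commutant H S\<close> \<open>T' \<in> commutant H S\<close> assms
      by (auto simp: commutant_def ext bounded_ops_closed subsetD)
    then show ?thesis
      using that by (simp add: commutant_def compose_bounded_ops ext) (simp add: compose_def)
  qed
  assume l: "snd ` set l \<subseteq> commutant H S"
  then have lb: "snd ` set l \<subseteq> bounded_ops H"
    by (auto simp: commutant_def)
  have "op_eval l (A x) = A (op_eval l x)" if "A \<in> S" "x \<in> carrier H" for A x
  proof -
    have A: "A \<in> bounded_ops H"
      using assms that(1) by blast
    show ?thesis
      using l
    proof (induction l)
      case Nil
      then show ?case by (simp add: bounded_ops_zero[OF A])
    next
      case (Cons p l)
      then have "snd p \<in> bounded_ops H" "snd ` set l \<subseteq> bounded_ops H" "snd p (A x) = A (snd p x)"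
        using that by (auto simp: commutant_def ext)
      then show ?case
        using Cons that(2) A by (simp add: bounded_ops_add bounded_ops_smult bounded_ops_closed)
    qed
  qed
  moreover have "A x \<in> carrier H" if "A \<in> S" "x \<in> carrier H" for A x
    using that assms bounded_ops_closed by blast
  ultimately show "op_comb l \<in> commutant H S"
    using op_comb_bounded[OF lb] lb by (simp add: commutant_def ext) (simp add: op_comb_def)
qed

end

section \<open>The unitary group of a von Neumann algebra with a trace\<close>

locale tracial_algebra =
  fixes H :: "'h hilbert" and M :: "('h \<Rightarrow> 'h) set" and \<tau> :: "('h \<Rightarrow> 'h) \<Rightarrow> complex"
  assumes von_neumann_algebra: "von_neumann_algebra H M"
    and trace_state: "faithful_normal_tracial_state H M \<tau>"

sublocale tracial_algebra \<subseteq> complex_hilbert H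
  using von_neumann_algebra by unfold_locales (simp add: von_neumann_algebra_def)

context tracial_algebra
begin

abbreviation U where "U \<equiv> unitary_group H M"

lemma M_bounded: "M \<subseteq> bounded_ops H"
  using von_neumann_algebra by (simp add: von_neumann_algebra_def)

lemma M_closed:
  "id_op H \<in> M"
  "T \<in> M \<Longrightarrow> T' \<in> M \<Longrightarrow> compose (carrier H) T T' \<in> M"
  "snd ` set l \<subseteq> M \<Longrightarrow> op_comb l \<in> M"
proof -
  have "commutant H M \<subseteq> bounded_ops H" and M: "commutant H (commutant H M) = M"
    using von_neumann_algebra by (auto simp: von_neumann_algebra_def commutant_def)
  then show "id_op H \<in> M"
    "T \<in> M \<Longrightarrow> T' \<in> M \<Longrightarrow> compose (carrier H) T T' \<in> M"
    "snd ` set l \<subseteq> M \<Longrightarrow> op_comb l \<in> M"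
    using commutant_closed[of "commutant H M"] by auto
qed

lemma U_simps:
  "u \<in> carrier U \<longleftrightarrow> u \<in> M \<and> unitary_op H u" "u \<otimes>\<^bsub>U\<^esub> v = compose (carrier H) u v" "\<one>\<^bsub>U\<^esub> = id_op H"
  by (simp_all add: unitary_group_def)

text \<open>The inverse of a unitary is its adjoint, and \<open>M\<close> is closed under
  adjoints.\<close>

lemma uinv_U: "u \<in> carrier U \<Longrightarrow> uinv u \<in> carrier U"
  using von_neumann_algebra adj_op_unitary[of u] unitary_uinv[of u]
  by (auto simp: U_simps von_neumann_algebra_def)

lemma compose_uinv: "unitary_op H u \<Longrightarrow> compose (carrier H) (uinv u) u = id_op H"
  by (simp add: compose_def id_op_def fun_eq_iff)

lemma group_U: "group U"
proof (rule groupI)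
  fix u assume u: "u \<in> carrier U"
  then show "\<exists>v\<in>carrier U. v \<otimes>\<^bsub>U\<^esub> u = \<one>\<^bsub>U\<^esub>"
    using uinv_U[OF u] by (intro bexI[of _ "uinv u"]) (auto simp: U_simps compose_uinv)
  show "\<one>\<^bsub>U\<^esub> \<otimes>\<^bsub>U\<^esub> u = u"
    using u bounded_ops_extensional[of u] M_bounded bounded_ops_closed[of u]
    by (auto simp: U_simps compose_def id_op_def fun_eq_iff extensional_def)
next
  fix u v w assume "u \<in> carrier U" "v \<in> carrier U" "w \<in> carrier U"
  then show "u \<otimes>\<^bsub>U\<^esub> v \<otimes>\<^bsub>U\<^esub> w = u \<otimes>\<^bsub>U\<^esub> (v \<otimes>\<^bsub>U\<^esub> w)"
    by (auto simp: U_simps compose_def fun_eq_iff)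
qed (auto simp: U_simps M_closed unitary_id_op unitary_compose)

lemma inv_U: "u \<in> carrier U \<Longrightarrow> inv\<^bsub>U\<^esub> u = uinv u"
  using uinv_U by (intro group.inv_equality[OF group_U]) (auto simp: U_simps compose_uinv)

lemma trace_id: "\<tau> (id_op H) = 1"
  using trace_state by (simp add: faithful_normal_tracial_state_def)

lemma trace_compose_commute:
  "S \<in> M \<Longrightarrow> T \<in> M \<Longrightarrow> \<tau> (compose (carrier H) S T) = \<tau> (compose (carrier H) T S)"
  using trace_state by (simp add: faithful_normal_tracial_state_def)

lemma trace_normal:
  obtains \<xi> \<eta> where "\<forall>n. \<xi> n \<in> carrier H" "\<forall>n. \<eta> n \<in> carrier H"
    "summable (\<lambda>n. (hnorm H (\<xi> n))\<^sup>2)" "summable (\<lambda>n. (hnorm H (\<eta> n))\<^sup>2)"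
    "\<forall>T\<in>M. (\<lambda>n. cinner H (T (\<xi> n)) (\<eta> n)) sums \<tau> T"
proof -
  have "\<tau> \<in> predual H M"
    using trace_state by (simp add: faithful_normal_tracial_state_def)
  then obtain \<xi> \<eta> where *: "\<forall>n. \<xi> n \<in> carrier H \<and> \<eta> n \<in> carrier H"
    "summable (\<lambda>n. (hnorm H (\<xi> n))\<^sup>2)" "summable (\<lambda>n. (hnorm H (\<eta> n))\<^sup>2)"
    "\<forall>T\<in>M. (\<lambda>n. cinner H (T (\<xi> n)) (\<eta> n)) sums \<tau> T"
    unfolding predual_def by blast
  then show thesis
    by (intro that[of \<xi> \<eta>]) simp_all
qed

text \<open>Linearity of \<open>\<tau>\<close> is drawn from normality: on \<open>M\<close> the
  trace is a series of functionals \<open>T \<mapsto> \<langle>T \<xi>, \<eta>\<rangle>\<close>, and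
  such series can be added and scaled term by term.\<close>

lemma trace_op_comb_compose:
  assumes "snd ` set l \<subseteq> M" "snd ` set m \<subseteq> M"
  shows "\<tau> (compose (carrier H) (op_comb l) (op_comb m)) = (\<Sum>(c, S)\<leftarrow>l. \<Sum>(d, T)\<leftarrow>m. c * d * \<tau> (compose (carrier H) S T))"
proof -
  obtain \<xi> \<eta> where "\<forall>n. \<xi> n \<in> carrier H" "\<forall>n. \<eta> n \<in> carrier H"
    and "\<forall>T\<in>M. (\<lambda>n. cinner H (T (\<xi> n)) (\<eta> n)) sums \<tau> T"
    by (rule trace_normal)
  then have \<xi>: "\<xi> n \<in> carrier H" and \<eta>: "\<eta> n \<in> carrier H"
    and sums: "T \<in> M \<Longrightarrow> (\<lambda>n. cinner H (T (\<xi> n)) (\<eta> n)) sums \<tau> T" for n T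
    by blast+
  have bdd: "snd ` set k \<subseteq> bounded_ops H" if "snd ` set k \<subseteq> M" for k :: "(complex \<times> ('h \<Rightarrow> 'h)) list"
    using that M_bounded by blast
  have 1: "(\<lambda>n. cinner H (op_eval k (\<xi> n)) (\<eta> n)) sums (\<Sum>(c, T)\<leftarrow>k. c * \<tau> T)"
    if "snd ` set k \<subseteq> M" for k
    using that
  proof (induction k)
    case Nil
    then show ?case using \<eta> by simp
  next
    case (Cons p k)
    have "(\<lambda>n. fst p * cinner H (snd p (\<xi> n)) (\<eta> n) + cinner H (op_eval k (\<xi> n)) (\<eta> n))
        sums (fst p * \<tau> (snd p) + (\<Sum>(c, T)\<leftarrow>k. c * \<tau> T))"
      using Cons by (intro sums_add sums_mult sums) auto
    moreover have "snd p \<in> bounded_ops H" "op_eval k (\<xi> n) \<in> carrier H" for n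
      using Cons.prems M_bounded \<xi> bdd[of k] by auto
    ultimately show ?case
      using \<xi> \<eta> by (simp add: bounded_ops_closed case_prod_unfold)
  qed
  \<comment> \<open>The head of the left list is absorbed into the operators of the right list,
    which leaves a single combination to which \<open>1\<close> applies.\<close>
  have 2: "(\<lambda>n. cinner H (op_eval l (op_eval m (\<xi> n))) (\<eta> n))
      sums (\<Sum>(c, S)\<leftarrow>l. \<Sum>(d, T)\<leftarrow>m. c * d * \<tau> (compose (carrier H) S T))"
    using assms(1)
  proof (induction l)
    case Nil
    then show ?case using \<eta> by simp
  next
    case (Cons p l)
    let ?m = "map (\<lambda>(d, T). (d, compose (carrier H) (snd p) T)) m"
    have p: "snd p \<in> M" "snd p \<in> bounded_ops H" and l: "snd ` set l \<subseteq> M"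
      using Cons.prems M_bounded by auto
    have "snd ` set ?m \<subseteq> M"
      using assms(2) p(1) by (force intro: M_closed(2))
    then have "(\<lambda>n. fst p * cinner H (op_eval ?m (\<xi> n)) (\<eta> n) + cinner H (op_eval l (op_eval m (\<xi> n))) (\<eta> n))
        sums (fst p * (\<Sum>(d, T)\<leftarrow>?m. d * \<tau> T) + (\<Sum>(c, S)\<leftarrow>l. \<Sum>(d, T)\<leftarrow>m. c * d * \<tau> (compose (carrier H) S T)))"
      using Cons.IH[OF l] by (intro sums_add sums_mult 1)
    moreover have "op_eval ?m (\<xi> n) = snd p (op_eval m (\<xi> n))" for n
      using bounded_ops_op_eval[OF p(2) bdd[OF assms(2)] \<xi>] by simp
    moreover have "fst p * (\<Sum>(d, T)\<leftarrow>?m. d * \<tau> T) = (\<Sum>(d, T)\<leftarrow>m. fst p * d * \<tau> (compose (carrier H) (snd p) T))"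
      by (simp add: sum_list_const_mult [symmetric] case_prod_unfold o_def mult.assoc)
    ultimately show ?case
      using \<xi> \<eta> p bdd[OF l] bdd[OF assms(2)] by (simp add: bounded_ops_closed case_prod_unfold)
  qed
  have "compose (carrier H) (op_comb l) (op_comb m) \<in> M"
    using assms by (intro M_closed)
  then have "(\<lambda>n. cinner H (compose (carrier H) (op_comb l) (op_comb m) (\<xi> n)) (\<eta> n))
      sums \<tau> (compose (carrier H) (op_comb l) (op_comb m))"
    by (rule sums)
  moreover have "compose (carrier H) (op_comb l) (op_comb m) (\<xi> n) = op_eval l (op_eval m (\<xi> n))" for n
    using \<xi> bdd[OF assms(2)] by (simp add: compose_def op_comb_def)
  ultimately show ?thesis
    using 2 by (simp add: sums_unique2)
qed

text \<open>The form is the squared 2-norm of \<open>T = op_comb l\<close>. The trace property is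
  used twice: on each term, to reach the trace of \<open>T\<close> times its adjoint, and then on
  the whole product, to reverse that order.\<close>

lemma kernel_form_trace:
  assumes "snd ` set l \<subseteq> carrier U"
  shows "kernel_form (\<lambda>s t. \<tau> (inv\<^bsub>U\<^esub> t \<otimes>\<^bsub>U\<^esub> s)) l l = \<tau> (compose (carrier H) (adj_op H (op_comb l)) (op_comb l))"
proof -
  let ?l = "map (\<lambda>p. (cnj (fst p), uinv (snd p))) l"
  have U: "snd p \<in> carrier U" if "p \<in> set l" for p
    using assms that by auto
  have l: "snd ` set l \<subseteq> M" "snd ` set ?l \<subseteq> M" and unitary: "\<forall>p\<in>set l. unitary_op H (snd p)"
    using U uinv_U by (force simp: U_simps)+
  have "\<tau> (inv\<^bsub>U\<^esub> (snd q) \<otimes>\<^bsub>U\<^esub> snd p) = \<tau> (compose (carrier H) (snd p) (uinv (snd q)))"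
    if "p \<in> set l" "q \<in> set l" for p q
    using U[OF that(1)] U[OF that(2)] uinv_U[of "snd q"]
    by (simp add: inv_U) (simp add: U_simps trace_compose_commute)
  then have "kernel_form (\<lambda>s t. \<tau> (inv\<^bsub>U\<^esub> t \<otimes>\<^bsub>U\<^esub> s)) l l = \<tau> (compose (carrier H) (op_comb l) (op_comb ?l))"
    unfolding trace_op_comb_compose[OF l]
    by (simp add: kernel_form_def case_prod_unfold o_def cong: map_cong)
  also have "\<dots> = \<tau> (compose (carrier H) (op_comb ?l) (op_comb l))"
    using l by (intro trace_compose_commute M_closed)
  finally show ?thesis
    using unitary by (simp add: adj_op_op_comb)
qed

lemma pos_def_trace: "pos_def_function U \<tau>"
proof -
  have "pos_def_kernel (carrier U) (\<lambda>s t. \<tau> (inv\<^bsub>U\<^esub> t \<otimes>\<^bsub>U\<^esub> s))"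
  proof
    fix l :: "(complex \<times> ('h \<Rightarrow> 'h)) list"
    assume l: "snd ` set l \<subseteq> carrier U"
    then have "op_comb l \<in> M"
      by (intro M_closed) (auto simp: U_simps)
    then show "kernel_form (\<lambda>s t. \<tau> (inv\<^bsub>U\<^esub> t \<otimes>\<^bsub>U\<^esub> s)) l l \<in> \<real>\<^sub>\<ge>\<^sub>0"
      using kernel_form_trace[OF l] trace_state by (simp add: faithful_normal_tracial_state_def)
  qed
  then show ?thesis
    by (simp add: pos_def_function_def pos_def_function_axioms_def group_U)
qed

text \<open>The list \<open>?l\<close> stands for \<open>u - 1\<close>, whose squared 2-norm is
  \<open>2 * (1 - Re (\<tau> u))\<close>; by faithfulness it vanishes only for
  \<open>u = 1\<close>.\<close>

lemma trace_faithful: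
  assumes u: "u \<in> carrier U" "u \<noteq> \<one>\<^bsub>U\<^esub>"
  shows "0 < 1 - Re (\<tau> u)"
proof -
  interpret U: pos_def_function U \<tau> by (rule pos_def_trace)
  let ?l = "[(1, u), (-1, \<one>\<^bsub>U\<^esub>)]"
  have l: "snd ` set ?l \<subseteq> carrier U"
    using u(1) by simp
  have one: "\<tau> \<one>\<^bsub>U\<^esub> = 1"
    by (simp add: U_simps trace_id)
  let ?q = "kernel_form (\<lambda>s t. \<tau> (inv\<^bsub>U\<^esub> t \<otimes>\<^bsub>U\<^esub> s)) ?l ?l"
  have Re: "Re ?q = 2 * (1 - Re (\<tau> u))"
    using u(1) U.Re_inv[OF u(1)] one by (simp add: kernel_form_def)
  have "?q \<in> \<real>\<^sub>\<ge>\<^sub>0"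
    by (rule U.form_nonneg[OF l])
  moreover have "?q \<noteq> 0"
  proof
    assume "?q = 0"
    moreover have "op_comb ?l \<in> M"
      using l by (intro M_closed) (auto simp: U_simps)
    ultimately have zero: "op_comb ?l = (\<lambda>x\<in>carrier H. \<zero>\<^bsub>H\<^esub>)"
      using kernel_form_trace[OF l] trace_state by (simp add: faithful_normal_tracial_state_def)
    have "u = id_op H"
    proof (rule extensionalityI)
      show "u \<in> extensional (carrier H)" "id_op H \<in> extensional (carrier H)"
        using u(1) M_bounded bounded_ops_extensional by (auto simp: U_simps id_op_def)
      fix x assume x: "x \<in> carrier H"
      then have ux: "u x \<in> carrier H"
        using u(1) by (simp add: U_simps)
      have "op_eval ?l x = \<zero>\<^bsub>H\<^esub>"
        using fun_cong[OF zero, of x] x by (simp add: op_comb_def)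
      then have *: "1 \<odot>\<^bsub>H\<^esub> u x \<oplus>\<^bsub>H\<^esub> ((-1) \<odot>\<^bsub>H\<^esub> x \<oplus>\<^bsub>H\<^esub> \<zero>\<^bsub>H\<^esub>) = \<zero>\<^bsub>H\<^esub>"
        using x by (simp add: U_simps id_op_def)
      have "cinner H (u x) z = cinner H x z" if z: "z \<in> carrier H" for z
        using arg_cong[OF *, of "\<lambda>y. cinner H y z"] x ux z by simp
      then show "u x = id_op H x"
        using x ux by (simp add: id_op_def cinner_eqI)
    qed
    then show False
      using u(2) by (simp add: U_simps)
  qed
  ultimately have "Re ?q > 0"
    by (auto simp: complex_nonneg_Reals_iff complex_eq_iff)
  then show ?thesis
    using Re by simp
qed

section \<open>Separability of the unitary group in the 2-norm\<close>

text \<open>It places the unitaries in the predual, where the separability hypothesis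
  applies.\<close>

definition trace_functional :: "('h \<Rightarrow> 'h) \<Rightarrow> ('h \<Rightarrow> 'h) \<Rightarrow> complex" where
  "trace_functional u = (\<lambda>T\<in>M. \<tau> (compose (carrier H) (uinv u) T))"

text \<open>Moving \<open>uinv u\<close> across the inner product replaces \<open>\<eta> n\<close>
  by \<open>u (\<eta> n)\<close>, which has the same norm, so square-summability survives.\<close>

lemma trace_functional_predual:
  assumes u: "u \<in> carrier U"
  shows "trace_functional u \<in> predual H M"
proof -
  have unitary: "unitary_op H u" and M: "uinv u \<in> M"
    using u uinv_U[OF u] by (auto simp: U_simps)
  obtain \<xi> \<eta> where "\<forall>n. \<xi> n \<in> carrier H" "\<forall>n. \<eta> n \<in> carrier H"
    and summable: "summable (\<lambda>n. (hnorm H (\<xi> n))\<^sup>2)" "summable (\<lambda>n. (hnorm H (\<eta> n))\<^sup>2)"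
    and "\<forall>T\<in>M. (\<lambda>n. cinner H (T (\<xi> n)) (\<eta> n)) sums \<tau> T"
    by (rule trace_normal)
  then have \<xi>: "\<xi> n \<in> carrier H" and \<eta>: "\<eta> n \<in> carrier H"
    and sums: "T \<in> M \<Longrightarrow> (\<lambda>n. cinner H (T (\<xi> n)) (\<eta> n)) sums \<tau> T" for n T
    by blast+
  have "(\<lambda>n. cinner H (T (\<xi> n)) (u (\<eta> n))) sums trace_functional u T" if T: "T \<in> M" for T
  proof -
    have "cinner H (compose (carrier H) (uinv u) T (\<xi> n)) (\<eta> n) = cinner H (T (\<xi> n)) (u (\<eta> n))" for n
      using \<xi> \<eta> T M_bounded unitary by (simp add: compose_def cinner_uinv' bounded_ops_closed subsetD)
    then show ?thesis
      using sums[OF M_closed(2)[OF M T]] T by (simp add: trace_functional_def)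
  qed
  moreover have "trace_functional u \<in> extensional M"
    by (simp add: trace_functional_def)
  ultimately show ?thesis
    unfolding predual_def
    by (intro CollectI conjI exI[of _ \<xi>] exI[of _ "\<lambda>n. u (\<eta> n)"]) (use \<xi> \<eta> summable unitary in simp_all)
qed

text \<open>The label of \<open>u\<close> is a point of the countable dense set within
  \<open>e / 2\<close> of its functional. If \<open>u\<close> and \<open>v\<close> share a label,
  their functionals differ by at most \<open>e\<close> on the unit ball; evaluated at
  \<open>u\<close> itself they are 1 and \<open>\<tau> (inv v \<otimes> u)\<close>.\<close>

lemma separable_trace_norm:
  assumes "separable_predual H M" "e > 0"
  shows "\<exists>d :: ('h \<Rightarrow> 'h) \<Rightarrow> ('h \<Rightarrow> 'h) \<Rightarrow> complex. countable (d ` carrier U) \<and>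
    (\<forall>u\<in>carrier U. \<forall>v\<in>carrier U. d u = d v \<longrightarrow> 1 - Re (\<tau> (inv\<^bsub>U\<^esub> v \<otimes>\<^bsub>U\<^esub> u)) \<le> e)"
proof -
  obtain D where D: "countable D" and
    dense: "\<forall>\<phi>\<in>predual H M. \<forall>e>0. \<exists>\<psi>\<in>D. \<forall>T\<in>unit_ball_ops H M. cmod (\<phi> T - \<psi> T) \<le> e"
    using assms(1) by (auto simp: separable_predual_def)
  have "\<forall>u\<in>carrier U. \<exists>\<psi>\<in>D. \<forall>T\<in>unit_ball_ops H M. cmod (trace_functional u T - \<psi> T) \<le> e / 2"
    using dense trace_functional_predual half_gt_zero[OF assms(2)] by blast
  then obtain d where d: "\<And>u. u \<in> carrier U \<Longrightarrow> d u \<in> D"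
    "\<And>u T. u \<in> carrier U \<Longrightarrow> T \<in> unit_ball_ops H M \<Longrightarrow> cmod (trace_functional u T - d u T) \<le> e / 2"
    by metis
  have "1 - Re (\<tau> (inv\<^bsub>U\<^esub> v \<otimes>\<^bsub>U\<^esub> u)) \<le> e" if u: "u \<in> carrier U" and v: "v \<in> carrier U" and "d u = d v" for u v
  proof -
    have "u \<in> unit_ball_ops H M"
      using u by (auto simp: unit_ball_ops_def U_simps)
    then have "cmod (trace_functional u u - d u u) \<le> e / 2" "cmod (trace_functional v u - d u u) \<le> e / 2"
      using d(2)[OF u, of u] d(2)[OF v, of u] \<open>d u = d v\<close> by simp_all
    then have "cmod (trace_functional u u - trace_functional v u) \<le> e"
      using norm_triangle_ineq4[of "trace_functional u u - d u u" "trace_functional v u - d u u"] by simp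
    moreover have "trace_functional u u = 1" "trace_functional v u = \<tau> (inv\<^bsub>U\<^esub> v \<otimes>\<^bsub>U\<^esub> u)"
      using u v by (simp_all add: trace_functional_def inv_U) (simp_all add: U_simps compose_uinv trace_id)
    ultimately show ?thesis
      using complex_Re_le_cmod[of "1 - \<tau> (inv\<^bsub>U\<^esub> v \<otimes>\<^bsub>U\<^esub> u)"] by simp
  qed
  moreover have "countable (d ` carrier U)"
    using countable_subset[OF _ D] d(1) by (simp add: image_subset_iff)
  ultimately show ?thesis
    by (intro exI[of _ d] conjI ballI impI)
qed

end

section \<open>From embedded quotients to homomorphisms\<close>

text \<open>The quotient map is followed by the inverse of the given isomorphism, whose injectivity
  leaves the kernel equal to \<open>N\<close>.\<close>

lemma iso_quotient_hom:
  assumes "N \<lhd> \<Gamma>" "group U" "subgroup K U" "U\<lparr>carrier := K\<rparr> \<cong> \<Gamma> Mod N"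
  obtains \<rho> where "\<rho> \<in> hom \<Gamma> U" "kernel \<Gamma> U \<rho> = N"
proof -
  interpret N: normal N \<Gamma> by (rule assms(1))
  interpret U: group U by (rule assms(2))
  interpret K: group "U\<lparr>carrier := K\<rparr>"
    using assms(3) U.is_group by (rule subgroup.subgroup_is_group)
  obtain h where h: "h \<in> iso (\<Gamma> Mod N) (U\<lparr>carrier := K\<rparr>)"
    using K.iso_sym[OF assms(4)] by (auto simp: is_iso_def)
  interpret Q: group "\<Gamma> Mod N" by (rule N.factorgroup_is_group)
  interpret h: group_hom "\<Gamma> Mod N" "U\<lparr>carrier := K\<rparr>" h
    using h by unfold_locales (simp add: iso_def)
  have inj: "inj_on h (carrier (\<Gamma> Mod N))"
    using h by (simp add: iso_def bij_betw_def)
  let ?q = "\<lambda>a. N #>\<^bsub>\<Gamma>\<^esub> a"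
  interpret q: group_hom \<Gamma> "\<Gamma> Mod N" ?q
    by (rule group_hom_rcoset[OF assms(1)])
  have "h \<circ> ?q \<in> hom \<Gamma> (U\<lparr>carrier := K\<rparr>)"
    using q.homh h.homh by (rule hom_compose)
  then have "h \<circ> ?q \<in> hom \<Gamma> U"
    using subgroup.subset[OF assms(3)] by (auto simp: hom_def)
  moreover have "kernel \<Gamma> U (h \<circ> ?q) = kernel \<Gamma> (\<Gamma> Mod N) ?q"
  proof -
    have "h y = \<one>\<^bsub>U\<^esub> \<longleftrightarrow> y = \<one>\<^bsub>\<Gamma> Mod N\<^esub>" if "y \<in> carrier (\<Gamma> Mod N)" for y
      using inj_on_eq_iff[OF inj that Q.one_closed] h.hom_one by simp
    then show ?thesis
      using q.hom_closed by (auto simp only: kernel_def o_apply)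
  qed
  ultimately show thesis
    using that kernel_rcoset[OF assms(1)] by simp
qed

theorem theorem2:
  fixes \<Gamma> :: "('g, 'm) monoid_scheme"
    and N :: "'i \<Rightarrow> 'g set" and I :: "'i set"
    and H :: "'h hilbert" and M :: "('h \<Rightarrow> 'h) set"
  assumes "group \<Gamma>" and "property_T \<Gamma>"
    and "uncountable I"
    and "\<And>\<alpha>. \<alpha> \<in> I \<Longrightarrow> N \<alpha> \<lhd> \<Gamma>"
    and "\<And>\<alpha> \<beta>. \<alpha> \<in> I \<Longrightarrow> \<beta> \<in> I \<Longrightarrow> \<alpha> \<noteq> \<beta> \<Longrightarrow> \<not> (\<Gamma> Mod N \<alpha>) \<cong> (\<Gamma> Mod N \<beta>)"
    and "\<And>\<alpha>. \<alpha> \<in> I \<Longrightarrow> is_simple (\<Gamma> Mod N \<alpha>)"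
    and "\<And>\<alpha>. \<alpha> \<in> I \<Longrightarrow> icc (\<Gamma> Mod N \<alpha>)"
    and "II1_factor H M" and "separable_predual H M"
  shows "countable {\<alpha> \<in> I. \<exists>K. subgroup K (unitary_group H M) \<and>
           (unitary_group H M)\<lparr>carrier := K\<rparr> \<cong> (\<Gamma> Mod N \<alpha>)}"
proof -
  obtain \<tau> where "tracial_algebra H M \<tau>"
    using assms(8) by (auto simp: II1_factor_def factor_def tracial_algebra_def)
  then interpret tracial_algebra H M \<tau> .
  let ?J = "{\<alpha> \<in> I. \<exists>K. subgroup K U \<and> U\<lparr>carrier := K\<rparr> \<cong> (\<Gamma> Mod N \<alpha>)}"
  have "\<exists>\<rho>. \<rho> \<in> hom \<Gamma> U \<and> kernel \<Gamma> U \<rho> = N \<alpha>" if "\<alpha> \<in> ?J" for \<alpha>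
    using that iso_quotient_hom[OF assms(4) group_U] by blast
  then have "\<exists>\<rho>. \<forall>\<alpha>\<in>?J. \<rho> \<alpha> \<in> hom \<Gamma> U \<and> kernel \<Gamma> U (\<rho> \<alpha>) = N \<alpha>"
    by (intro bchoice ballI)
  then obtain \<rho> where \<rho>: "\<forall>\<alpha>\<in>?J. \<rho> \<alpha> \<in> hom \<Gamma> U \<and> kernel \<Gamma> U (\<rho> \<alpha>) = N \<alpha>" ..
  \<comment> \<open>The tolerance becomes known only inside the counting argument, through property
    (T), so a labelling is chosen for every positive \<open>e\<close> at once.\<close>
  have "\<exists>d. \<forall>e\<in>{0<..}. countable ((d e :: ('h \<Rightarrow> 'h) \<Rightarrow> ('h \<Rightarrow> 'h) \<Rightarrow> complex) ` carrier U) \<and>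
      (\<forall>u\<in>carrier U. \<forall>v\<in>carrier U. d e u = d e v \<longrightarrow> 1 - Re (\<tau> (inv\<^bsub>U\<^esub> v \<otimes>\<^bsub>U\<^esub> u)) \<le> e)"
    using separable_trace_norm[OF assms(9)] by (intro bchoice ballI) simp
  then obtain d :: "real \<Rightarrow> ('h \<Rightarrow> 'h) \<Rightarrow> ('h \<Rightarrow> 'h) \<Rightarrow> complex"
    where d: "\<forall>e\<in>{0<..}. countable (d e ` carrier U) \<and>
      (\<forall>u\<in>carrier U. \<forall>v\<in>carrier U. d e u = d e v \<longrightarrow> 1 - Re (\<tau> (inv\<^bsub>U\<^esub> v \<otimes>\<^bsub>U\<^esub> u)) \<le> e)" ..
  show ?thesis
  proof (rule countable_simple_quotients_of_tracial_group[where \<rho> = \<rho> and d = d, OF assms(1,2) _ _ _ _ _ pos_def_trace _ _ trace_faithful])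
    \<comment> \<open>Non-isomorphism enters here: equal kernels would give the same quotient, which
      is isomorphic to itself.\<close>
    show "inj_on N ?J"
    proof (rule inj_onI, rule ccontr)
      fix \<alpha> \<beta> assume "\<alpha> \<in> ?J" "\<beta> \<in> ?J" "N \<alpha> = N \<beta>" "\<alpha> \<noteq> \<beta>"
      then show False
        using assms(5)[of \<alpha> \<beta>] by simp
    qed
    show "\<And>\<alpha>. \<alpha> \<in> ?J \<Longrightarrow> \<rho> \<alpha> \<in> hom \<Gamma> U" "\<And>\<alpha>. \<alpha> \<in> ?J \<Longrightarrow> kernel \<Gamma> U (\<rho> \<alpha>) = N \<alpha>"
      using bspec[OF \<rho>] by blast+
    show "\<And>e. e > 0 \<Longrightarrow> countable (d e ` carrier U)"
      "\<And>e u v. e > 0 \<Longrightarrow> u \<in> carrier U \<Longrightarrow> v \<in> carrier U \<Longrightarrow> d e u = d e v \<Longrightarrow>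
         1 - Re (\<tau> (inv\<^bsub>U\<^esub> v \<otimes>\<^bsub>U\<^esub> u)) \<le> e"
      using d by auto
  qed (use assms(4,6) in \<open>auto simp: U_simps trace_id trace_compose_commute\<close>)
qed

end
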